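(* The varieties $\mathbf{RLat}_n$ of rotational lattices of order $n$, $n\in\mathbb N=\{1,2,\dots\}$, are strongly tolerance factorable and pairwise non-equivalent (that is, $\mathbf{RLat}_m$ and $\mathbf{RLat}_n$ are not term equivalent if $m\ne n$), and each of them has proper tolerances. Moreover, none of the varieties $\mathbf{RLat}_n$, $n\in\mathbb N$, is term equivalent to any of the varieties $\mathcal S^{(k)}$, $k\in\mathbb N$.
   Context: Rotational lattices. A rotational lattice of order $n$ is an algebra $(L,\vee,\wedge,g_n)$ such that $(L,\vee,\wedge)$ is a lattice and $g_n$ is a unary operation that is an automorphism of the lattice $(L,\vee,\wedge)$ and satisfies the identity $g_n^n(x)=x$, where $g_n^n$ is the $n$-fold iterate of $g_n$. $\mathbf{RLat}_n$ is the variety of all these algebras. The varieties $\mathcal S^{(n)}$. For $2\le n\in\mathbb N$ and $1\le i\le n$, let $\mathcal S^{(n)}_i$ be the variety of type $\{f_n\}$, with $f_n$ an $n$-ary operation symbol, defined by the identity $f_n(x_1,\dots,x_n)=x_i$ (so its members are all nonempty sets $X$ with $f_n$ acting as the $i$-th projection). Let $\mathcal S^{(n)}=\mathcal S^{(n)}_1\vee\dots\vee\mathcal S^{(n)}_n$, the join in the lattice of all varieties of type $\{f_n\}$. Let $\mathcal S^{(1)}$ be the variety of sets (with no operations). Tolerances and blocks. A tolerance on an algebra $\mathcal A=(A,F)$ is a reflexive, symmetric relation $T\subseteq A^2$ compatible with all operations in $F$; $\mathrm{Tol}(\mathcal A)$ is the set of all tolerances of $\mathcal A$. A tolerance is proper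 if it is not a congruence. A block of $T$ is a maximal subset $B\subseteq A$ such that $B^2\subseteq T$; $\mathrm{Block}(T)$ is the set of all blocks of $T$. For every $n$-ary $f\in F$ and $B_1,\dots,B_n\in\mathrm{Block}(T)$ there is at least one $B\in\mathrm{Block}(T)$ with $\{f(b_1,\dots,b_n): b_1\in B_1,\dots,b_n\in B_n\}\subseteq B$. The algebra $\mathcal A$ is $T$-factorable if, for each $n$, each $n$-ary $f\in F$ and all $B_1,\dots,B_n\in\mathrm{Block}(T)$, this block $B$ is uniquely determined; in this case $f(B_1,\dots,B_n):=B$ defines the quotient algebra $\mathcal A/T=(\mathrm{Block}(T),F)$. The algebra $\mathcal A$ is tolerance factorable if it is $T$-factorable for all $T\in\mathrm{Tol}(\mathcal A)$. Properties of a variety $\mathcal W$. $\mathcal W$ is tolerance factorable if all of its members are tolerance factorable. $\mathcal W$ is strongly tolerance factorable if it is tolerance factorable and $\mathcal A/T\in\mathcal W$ for all $\mathcal A\in\mathcal W$ and all $T\in\mathrm{Tol}(\mathcal A)$. $\mathcal W$ has proper tolerances if at least one of its members has a proper tolerance. "Equivalent" means term equivalent (also called rationally equivalent) in the usual sense for varieties of possibly different types; e.g. the variety of Boolean algebras is equivalent to that of Boolean rings. *)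

theory Defs
  imports Main
begin

section \<open>Algebras, terms and varieties\<close>

text \<open>A similarity type maps the operation symbols it contains to their arities. A partial map is
  used because HOL types are nonempty, while the type of \<open>\<S>\<^sup>(\<^sup>1\<^sup>)\<close> has no operation symbol at all.\<close>

type_synonym 'f sim_type = "'f \<rightharpoonup> nat"

text \<open>Only the values of \<open>ops A f xs\<close> for symbols \<open>f\<close> of the similarity type and lists \<open>xs\<close> over the
  carrier whose length is the arity of \<open>f\<close> are meaningful.\<close>

record ('f, 'a) algebra =
  carrier :: "'a set"
  ops :: "'f \<Rightarrow> 'a list \<Rightarrow> 'a"

definition tuples :: "'a set \<Rightarrow> nat \<Rightarrow> 'a list set" where
  "tuples X n = {xs. length xs = n \<and> set xs \<subseteq> X}"

definition is_algebra :: "'f sim_type \<Rightarrow> ('f, 'a) algebra \<Rightarrow> bool" where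
  "is_algebra \<Sigma> A \<longleftrightarrow> carrier A \<noteq> {} \<and>
     (\<forall>f n. \<Sigma> f = Some n \<longrightarrow> (\<forall>xs\<in>tuples (carrier A) n. ops A f xs \<in> carrier A))"

definition same_algebra :: "'f sim_type \<Rightarrow> ('f, 'a) algebra \<Rightarrow> ('f, 'a) algebra \<Rightarrow> bool" where
  "same_algebra \<Sigma> A B \<longleftrightarrow> carrier A = carrier B \<and>
     (\<forall>f n. \<Sigma> f = Some n \<longrightarrow> (\<forall>xs\<in>tuples (carrier A) n. ops A f xs = ops B f xs))"

datatype 'f trm = Var nat | App 'f "'f trm list"

primrec vars :: "'f trm \<Rightarrow> nat set" where
  "vars (Var i) = {i}"
| "vars (App f ts) = \<Union> (set (map vars ts))"

primrec wf_trm :: "'f sim_type \<Rightarrow> 'f trm \<Rightarrow> bool" where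
  "wf_trm \<Sigma> (Var i) \<longleftrightarrow> True"
| "wf_trm \<Sigma> (App f ts) \<longleftrightarrow> \<Sigma> f = Some (length ts) \<and> list_all (\<lambda>b. b) (map (wf_trm \<Sigma>) ts)"

primrec eval_trm :: "('f, 'a) algebra \<Rightarrow> (nat \<Rightarrow> 'a) \<Rightarrow> 'f trm \<Rightarrow> 'a" where
  "eval_trm A \<rho> (Var i) = \<rho> i"
| "eval_trm A \<rho> (App f ts) = ops A f (map (eval_trm A \<rho>) ts)"

definition satisfies :: "('f, 'a) algebra \<Rightarrow> 'f trm \<times> 'f trm \<Rightarrow> bool" where
  "satisfies A e \<longleftrightarrow>
     (\<forall>\<rho>. range \<rho> \<subseteq> carrier A \<longrightarrow> eval_trm A \<rho> (fst e) = eval_trm A \<rho> (snd e))"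

definition models :: "'f sim_type \<Rightarrow> ('f trm \<times> 'f trm) set \<Rightarrow> ('f, 'a) algebra set" where
  "models \<Sigma> E = {A. is_algebra \<Sigma> A \<and> (\<forall>e\<in>E. satisfies A e)}"

text \<open>Varieties are equational classes. HOL has no class of all algebras over all sets, so a variety
  is rendered by its members whose carriers are subsets of a type \<open>'a\<close>. For countable types of algebras
  and infinite \<open>'a\<close> these members determine the variety. Over a finite \<open>'a\<close> different varieties may
  coincide, so joins and term equivalence have their intended meaning for infinite \<open>'a\<close> only.\<close>

definition is_variety :: "'f sim_type \<Rightarrow> ('f, 'a) algebra set \<Rightarrow> bool" where
  "is_variety \<Sigma> V \<longleftrightarrow>
     (\<exists>E. (\<forall>e\<in>E. wf_trm \<Sigma> (fst e) \<and> wf_trm \<Sigma> (snd e)) \<and> V = models \<Sigma> E)"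

text \<open>The join in the lattice of all varieties of a given type: the least variety containing all
  members of \<open>K\<close>.\<close>

definition variety_join :: "'f sim_type \<Rightarrow> ('f, 'a) algebra set set \<Rightarrow> ('f, 'a) algebra set" where
  "variety_join \<Sigma> K = \<Inter> {V. is_variety \<Sigma> V \<and> (\<forall>W\<in>K. W \<subseteq> V)}"


section \<open>Term equivalence\<close>

text \<open>An interpretation assigns to every \<open>n\<close>-ary symbol of the first type a term of the second type
  in the variables \<open>Var 0, \<dots>, Var (n - 1)\<close>.\<close>

definition interprets :: "'f sim_type \<Rightarrow> 'g sim_type \<Rightarrow> ('f \<Rightarrow> 'g trm) \<Rightarrow> bool" where
  "interprets \<Sigma> \<Delta> \<sigma> \<longleftrightarrow>
     (\<forall>f n. \<Sigma> f = Some n \<longrightarrow> wf_trm \<Delta> (\<sigma> f) \<and> vars (\<sigma> f) \<subseteq> {..<n})"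

definition term_reduct :: "('f \<Rightarrow> 'g trm) \<Rightarrow> ('g, 'a) algebra \<Rightarrow> ('f, 'a) algebra" where
  "term_reduct \<sigma> B =
     \<lparr>carrier = carrier B, ops = (\<lambda>f xs. eval_trm B (\<lambda>i. xs ! i) (\<sigma> f))\<rparr>"

definition term_equivalent ::
  "'f sim_type \<Rightarrow> ('f, 'a) algebra set \<Rightarrow> 'g sim_type \<Rightarrow> ('g, 'a) algebra set \<Rightarrow> bool" where
  "term_equivalent \<Sigma> V \<Delta> W \<longleftrightarrow>
     (\<exists>\<sigma> \<tau>. interprets \<Sigma> \<Delta> \<sigma> \<and> interprets \<Delta> \<Sigma> \<tau> \<and>
        (\<forall>A\<in>V. term_reduct \<tau> A \<in> W \<and> same_algebra \<Sigma> (term_reduct \<sigma> (term_reduct \<tau> A)) A) \<and>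
        (\<forall>B\<in>W. term_reduct \<sigma> B \<in> V \<and> same_algebra \<Delta> (term_reduct \<tau> (term_reduct \<sigma> B)) B))"


section \<open>Tolerances\<close>

definition compatible :: "'f sim_type \<Rightarrow> ('f, 'a) algebra \<Rightarrow> ('a \<times> 'a) set \<Rightarrow> bool" where
  "compatible \<Sigma> A T \<longleftrightarrow>
     (\<forall>f n. \<Sigma> f = Some n \<longrightarrow>
        (\<forall>xs\<in>tuples (carrier A) n. \<forall>ys\<in>tuples (carrier A) n.
           (\<forall>i<n. (xs ! i, ys ! i) \<in> T) \<longrightarrow> (ops A f xs, ops A f ys) \<in> T))"

definition Tol :: "'f sim_type \<Rightarrow> ('f, 'a) algebra \<Rightarrow> ('a \<times> 'a) set set" where
  "Tol \<Sigma> A = {T. T \<subseteq> carrier A \<times> carrier A \<and> refl_on (carrier A) T \<and> sym T \<and> compatible \<Sigma> A T}"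

definition congruence :: "'f sim_type \<Rightarrow> ('f, 'a) algebra \<Rightarrow> ('a \<times> 'a) set \<Rightarrow> bool" where
  "congruence \<Sigma> A T \<longleftrightarrow> equiv (carrier A) T \<and> compatible \<Sigma> A T"

definition Block :: "('f, 'a) algebra \<Rightarrow> ('a \<times> 'a) set \<Rightarrow> 'a set set" where
  "Block A T = {B. B \<subseteq> carrier A \<and> B \<times> B \<subseteq> T \<and>
     (\<forall>C. B \<subseteq> C \<and> C \<subseteq> carrier A \<and> C \<times> C \<subseteq> T \<longrightarrow> C = B)}"

definition complex_op :: "('f, 'a) algebra \<Rightarrow> 'f \<Rightarrow> 'a set list \<Rightarrow> 'a set" where
  "complex_op A f Bs = {ops A f bs |bs. list_all2 (\<in>) bs Bs}"

definition factorable_by :: "'f sim_type \<Rightarrow> ('f, 'a) algebra \<Rightarrow> ('a \<times> 'a) set \<Rightarrow> bool" where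
  "factorable_by \<Sigma> A T \<longleftrightarrow>
     (\<forall>f n. \<Sigma> f = Some n \<longrightarrow>
        (\<forall>Bs\<in>tuples (Block A T) n. \<exists>!B. B \<in> Block A T \<and> complex_op A f Bs \<subseteq> B))"

definition quotient_alg :: "('f, 'a) algebra \<Rightarrow> ('a \<times> 'a) set \<Rightarrow> ('f, 'a set) algebra" where
  "quotient_alg A T =
     \<lparr>carrier = Block A T, ops = (\<lambda>f Bs. THE B. B \<in> Block A T \<and> complex_op A f Bs \<subseteq> B)\<rparr>"

definition tolerance_factorable_alg :: "'f sim_type \<Rightarrow> ('f, 'a) algebra \<Rightarrow> bool" where
  "tolerance_factorable_alg \<Sigma> A \<longleftrightarrow> (\<forall>T\<in>Tol \<Sigma> A. factorable_by \<Sigma> A T)"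

definition tolerance_factorable :: "'f sim_type \<Rightarrow> ('f, 'a) algebra set \<Rightarrow> bool" where
  "tolerance_factorable \<Sigma> V \<longleftrightarrow> (\<forall>A\<in>V. tolerance_factorable_alg \<Sigma> A)"

text \<open>The elements of a quotient algebra are sets of elements of the original one. Hence
  the variety has to be supplied twice: \<open>V\<close> consists of its members over \<open>'a\<close>, and \<open>V'\<close> of its
  members over \<open>'a set\<close>.\<close>

definition strongly_tolerance_factorable ::
  "'f sim_type \<Rightarrow> ('f, 'a) algebra set \<Rightarrow> ('f, 'a set) algebra set \<Rightarrow> bool" where
  "strongly_tolerance_factorable \<Sigma> V V' \<longleftrightarrow>
     tolerance_factorable \<Sigma> V \<and> (\<forall>A\<in>V. \<forall>T\<in>Tol \<Sigma> A. quotient_alg A T \<in> V')"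

definition has_proper_tolerances :: "'f sim_type \<Rightarrow> ('f, 'a) algebra set \<Rightarrow> bool" where
  "has_proper_tolerances \<Sigma> V \<longleftrightarrow> (\<exists>A\<in>V. \<exists>T\<in>Tol \<Sigma> A. \<not> congruence \<Sigma> A T)"


section \<open>Rotational lattices\<close>

datatype rl_symbol = Join | Meet | Rot

definition rl_sig :: "rl_symbol sim_type" where
  "rl_sig = [Join \<mapsto> 2, Meet \<mapsto> 2, Rot \<mapsto> 1]"

definition lattice_on :: "'a set \<Rightarrow> ('a \<Rightarrow> 'a \<Rightarrow> 'a) \<Rightarrow> ('a \<Rightarrow> 'a \<Rightarrow> 'a) \<Rightarrow> bool" where
  "lattice_on L j m \<longleftrightarrow>
     L \<noteq> {} \<and>
     (\<forall>x\<in>L. \<forall>y\<in>L. j x y \<in> L \<and> m x y \<in> L) \<and>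
     (\<forall>x\<in>L. \<forall>y\<in>L. j x y = j y x \<and> m x y = m y x) \<and>
     (\<forall>x\<in>L. \<forall>y\<in>L. \<forall>z\<in>L. j (j x y) z = j x (j y z) \<and> m (m x y) z = m x (m y z)) \<and>
     (\<forall>x\<in>L. \<forall>y\<in>L. j x (m x y) = x \<and> m x (j x y) = x)"

definition lattice_automorphism ::
  "'a set \<Rightarrow> ('a \<Rightarrow> 'a \<Rightarrow> 'a) \<Rightarrow> ('a \<Rightarrow> 'a \<Rightarrow> 'a) \<Rightarrow> ('a \<Rightarrow> 'a) \<Rightarrow> bool" where
  "lattice_automorphism L j m g \<longleftrightarrow> bij_betw g L L \<and>
     (\<forall>x\<in>L. \<forall>y\<in>L. g (j x y) = j (g x) (g y) \<and> g (m x y) = m (g x) (g y))"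

definition RLat :: "nat \<Rightarrow> (rl_symbol, 'a) algebra set" where
  "RLat n = {A.
     let L = carrier A;
         j = (\<lambda>x y. ops A Join [x, y]);
         m = (\<lambda>x y. ops A Meet [x, y]);
         g = (\<lambda>x. ops A Rot [x])
     in lattice_on L j m \<and> lattice_automorphism L j m g \<and> (\<forall>x\<in>L. (g ^^ n) x = x)}"

lemma tuples_0: "tuples X 0 = {[]}"
  by (auto simp: tuples_def)

lemma tuples_Suc:
  "xs \<in> tuples X (Suc n) \<longleftrightarrow> (\<exists>x ys. xs = x # ys \<and> x \<in> X \<and> ys \<in> tuples X n)"
  by (cases xs) (auto simp: tuples_def)

lemma is_algebra_rl_sig:
  "is_algebra rl_sig A \<longleftrightarrow> carrier A \<noteq> {} \<and>
     (\<forall>x\<in>carrier A. \<forall>y\<in>carrier A.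
        ops A Join [x, y] \<in> carrier A \<and> ops A Meet [x, y] \<in> carrier A) \<and>
     (\<forall>x\<in>carrier A. ops A Rot [x] \<in> carrier A)"
proof -
  have *: "(\<forall>f n. rl_sig f = Some n \<longrightarrow> Q f n) \<longleftrightarrow> Q Join 2 \<and> Q Meet 2 \<and> Q Rot 1" for Q
  proof (intro iffI allI impI)
    assume "\<forall>f n. rl_sig f = Some n \<longrightarrow> Q f n"
    then show "Q Join 2 \<and> Q Meet 2 \<and> Q Rot 1"
      by (simp add: rl_sig_def)
  next
    fix f n
    assume "Q Join 2 \<and> Q Meet 2 \<and> Q Rot 1" "rl_sig f = Some n"
    then show "Q f n"
      by (cases f) (simp_all add: rl_sig_def)
  qed
  have tuples1: "(\<forall>xs\<in>tuples X 1. P xs) \<longleftrightarrow> (\<forall>x\<in>X. P [x])" for X :: "'a set" and P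
    by (auto simp: tuples_Suc tuples_0)
  have tuples2: "(\<forall>xs\<in>tuples X 2. P xs) \<longleftrightarrow> (\<forall>x\<in>X. \<forall>y\<in>X. P [x, y])" for X :: "'a set" and P
    by (auto simp: numeral_2_eq_2 tuples_Suc tuples_0)
  show ?thesis
    unfolding is_algebra_def * tuples1 tuples2 ball_conj_distrib by (simp only: conj_assoc)
qed

definition join_trm :: "rl_symbol trm \<Rightarrow> rl_symbol trm \<Rightarrow> rl_symbol trm" where
  "join_trm s t = App Join [s, t]"

definition meet_trm :: "rl_symbol trm \<Rightarrow> rl_symbol trm \<Rightarrow> rl_symbol trm" where
  "meet_trm s t = App Meet [s, t]"

definition rot_trm :: "rl_symbol trm \<Rightarrow> rl_symbol trm" where
  "rot_trm s = App Rot [s]"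

definition rl_identities :: "nat \<Rightarrow> (rl_symbol trm \<times> rl_symbol trm) set" where
  "rl_identities n =
     (let x = Var 0; y = Var 1; z = Var 2 in
      {(join_trm x y, join_trm y x),
       (meet_trm x y, meet_trm y x),
       (join_trm (join_trm x y) z, join_trm x (join_trm y z)),
       (meet_trm (meet_trm x y) z, meet_trm x (meet_trm y z)),
       (join_trm x (meet_trm x y), x),
       (meet_trm x (join_trm x y), x),
       (rot_trm (join_trm x y), join_trm (rot_trm x) (rot_trm y)),
       (rot_trm (meet_trm x y), meet_trm (rot_trm x) (rot_trm y)),
       ((rot_trm ^^ n) x, x)})"

lemma eval_rl_trm:
  "eval_trm A \<rho> (join_trm s t) = ops A Join [eval_trm A \<rho> s, eval_trm A \<rho> t]"
  "eval_trm A \<rho> (meet_trm s t) = ops A Meet [eval_trm A \<rho> s, eval_trm A \<rho> t]"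
  "eval_trm A \<rho> (rot_trm s) = ops A Rot [eval_trm A \<rho> s]"
  "eval_trm A \<rho> ((rot_trm ^^ n) s) = ((\<lambda>x. ops A Rot [x]) ^^ n) (eval_trm A \<rho> s)"
proof -
  show "eval_trm A \<rho> ((rot_trm ^^ n) s) = ((\<lambda>x. ops A Rot [x]) ^^ n) (eval_trm A \<rho> s)"
    by (induction n) (simp_all add: rot_trm_def)
qed (simp_all add: join_trm_def meet_trm_def rot_trm_def)

lemma wf_rl_trm:
  "wf_trm rl_sig (join_trm s t) \<longleftrightarrow> wf_trm rl_sig s \<and> wf_trm rl_sig t"
  "wf_trm rl_sig (meet_trm s t) \<longleftrightarrow> wf_trm rl_sig s \<and> wf_trm rl_sig t"
  "wf_trm rl_sig (rot_trm s) \<longleftrightarrow> wf_trm rl_sig s"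
  "wf_trm rl_sig ((rot_trm ^^ n) s) \<longleftrightarrow> wf_trm rl_sig s"
proof -
  show "wf_trm rl_sig ((rot_trm ^^ n) s) \<longleftrightarrow> wf_trm rl_sig s"
    by (induction n) (simp_all add: rot_trm_def rl_sig_def)
qed (simp_all add: join_trm_def meet_trm_def rot_trm_def rl_sig_def)

lemma all_valuations3:
  "(\<forall>\<rho>. range \<rho> \<subseteq> C \<longrightarrow> P (\<rho> 0) (\<rho> 1) (\<rho> (2::nat))) \<longleftrightarrow> (\<forall>x\<in>C. \<forall>y\<in>C. \<forall>z\<in>C. P x y z)"
proof (intro iffI ballI allI impI)
  fix x y z
  assume P: "\<forall>\<rho>. range \<rho> \<subseteq> C \<longrightarrow> P (\<rho> 0) (\<rho> 1) (\<rho> (2::nat))"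
    and xyz: "x \<in> C" "y \<in> C" "z \<in> C"
  define \<rho> where "\<rho> = (\<lambda>i::nat. if i = 0 then x else if i = 1 then y else z)"
  have "range \<rho> \<subseteq> C"
    using xyz by (auto simp: \<rho>_def)
  then have "P (\<rho> 0) (\<rho> 1) (\<rho> 2)"
    by (rule P[rule_format])
  then show "P x y z"
    by (simp add: \<rho>_def)
next
  fix \<rho> :: "nat \<Rightarrow> 'a"
  assume "\<forall>x\<in>C. \<forall>y\<in>C. \<forall>z\<in>C. P x y z" "range \<rho> \<subseteq> C"
  then show "P (\<rho> 0) (\<rho> 1) (\<rho> 2)"
    by (simp add: image_subset_iff)
qed

lemma bij_betw_of_funpow_id:
  assumes "n \<ge> 1" "\<forall>x\<in>C. g x \<in> C" "\<forall>x\<in>C. (g ^^ n) x = x"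
  shows "bij_betw g C C"
proof -
  obtain k where n: "n = Suc k"
    using assms(1) by (cases n) auto
  have c: "(g ^^ i) x \<in> C" if "x \<in> C" for x i
    using assms(2) that by (induction i) auto
  have inv: "(g ^^ k) (g x) = x" "g ((g ^^ k) x) = x" if "x \<in> C" for x
    using assms(3) that by (auto simp: n funpow_swap1)
  show ?thesis
    by (rule bij_betw_byWitness[where f' = "g ^^ k"]) (use assms(2) c inv in auto)
qed

theorem is_variety_RLat:
  assumes n: "n \<ge> 1"
  shows "is_variety rl_sig (RLat n)"
proof -
  have "A \<in> models rl_sig (rl_identities n) \<longleftrightarrow> A \<in> RLat n" for A :: "(rl_symbol, 'a) algebra"
  proof -
    define C where "C = carrier A"
    define j where "j = (\<lambda>x y. ops A Join [x, y])"
    define m where "m = (\<lambda>x y. ops A Meet [x, y])"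
    define g where "g = (\<lambda>x. ops A Rot [x])"
    have alg: "is_algebra rl_sig A \<longleftrightarrow>
        C \<noteq> {} \<and> (\<forall>x\<in>C. \<forall>y\<in>C. j x y \<in> C \<and> m x y \<in> C) \<and> (\<forall>x\<in>C. g x \<in> C)"
      unfolding is_algebra_rl_sig C_def j_def m_def g_def ..
    have ev: "eval_trm A \<rho> (join_trm s t) = j (eval_trm A \<rho> s) (eval_trm A \<rho> t)"
      "eval_trm A \<rho> (meet_trm s t) = m (eval_trm A \<rho> s) (eval_trm A \<rho> t)"
      "eval_trm A \<rho> (rot_trm s) = g (eval_trm A \<rho> s)"
      "eval_trm A \<rho> ((rot_trm ^^ n) s) = (g ^^ n) (eval_trm A \<rho> s)" for \<rho> s t
      by (simp_all add: eval_rl_trm j_def m_def g_def)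
    have sat: "satisfies A (s, t) \<longleftrightarrow> (\<forall>x\<in>C. \<forall>y\<in>C. \<forall>z\<in>C. P x y z)"
      if "\<And>\<rho>. eval_trm A \<rho> s = eval_trm A \<rho> t \<longleftrightarrow> P (\<rho> 0) (\<rho> 1) (\<rho> 2)" for s t P
      unfolding satisfies_def fst_conv snd_conv that C_def by (rule all_valuations3)
    have sat2: "satisfies A (s, t) \<longleftrightarrow> (\<forall>x\<in>C. \<forall>y\<in>C. P x y)"
      if "\<And>\<rho>. eval_trm A \<rho> s = eval_trm A \<rho> t \<longleftrightarrow> P (\<rho> 0) (\<rho> 1)" for s t P
      using sat[of s t "\<lambda>x y z. P x y"] that by blast
    have sat1: "satisfies A (s, t) \<longleftrightarrow> (\<forall>x\<in>C. P x)"
      if "\<And>\<rho>. eval_trm A \<rho> s = eval_trm A \<rho> t \<longleftrightarrow> P (\<rho> 0)" for s t P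
      using sat2[of s t "\<lambda>x y. P x"] that by blast
    have ids: "(\<forall>e\<in>rl_identities n. satisfies A e) \<longleftrightarrow>
        (\<forall>x\<in>C. \<forall>y\<in>C. j x y = j y x) \<and>
        (\<forall>x\<in>C. \<forall>y\<in>C. m x y = m y x) \<and>
        (\<forall>x\<in>C. \<forall>y\<in>C. \<forall>z\<in>C. j (j x y) z = j x (j y z)) \<and>
        (\<forall>x\<in>C. \<forall>y\<in>C. \<forall>z\<in>C. m (m x y) z = m x (m y z)) \<and>
        (\<forall>x\<in>C. \<forall>y\<in>C. j x (m x y) = x) \<and>
        (\<forall>x\<in>C. \<forall>y\<in>C. m x (j x y) = x) \<and>
        (\<forall>x\<in>C. \<forall>y\<in>C. g (j x y) = j (g x) (g y)) \<and>
        (\<forall>x\<in>C. \<forall>y\<in>C. g (m x y) = m (g x) (g y)) \<and>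
        (\<forall>x\<in>C. (g ^^ n) x = x)"
      unfolding rl_identities_def Let_def ball_simps simp_thms
      by (intro arg_cong2[where f = "(\<and>)"] sat sat2 sat1; simp only: ev eval_trm.simps(1))
    have RL: "A \<in> RLat n \<longleftrightarrow>
        lattice_on C j m \<and> lattice_automorphism C j m g \<and> (\<forall>x\<in>C. (g ^^ n) x = x)"
      unfolding RLat_def Let_def mem_Collect_eq C_def j_def m_def g_def ..
    have bij: "bij_betw g C C" if "\<forall>x\<in>C. g x \<in> C" "\<forall>x\<in>C. (g ^^ n) x = x"
      using bij_betw_of_funpow_id[OF n that] .
    have bij': "\<forall>x\<in>C. g x \<in> C" if "bij_betw g C C"
      using that by (auto dest: bij_betwE)
    show ?thesis
      unfolding models_def mem_Collect_eq alg ids RL lattice_on_def lattice_automorphism_def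
        ball_conj_distrib
      by (rule iffI; elim conjE; intro conjI;
          (assumption | (rule bij; assumption) | (rule bij'; assumption)))
  qed
  moreover have "\<forall>e\<in>rl_identities n. wf_trm rl_sig (fst e) \<and> wf_trm rl_sig (snd e)"
    by (simp add: rl_identities_def Let_def wf_rl_trm)
  ultimately show ?thesis
    unfolding is_variety_def by blast
qed


section \<open>Joins of varieties of projections\<close>

text \<open>The unique element of \<open>unit\<close> plays the role of the operation symbol \<open>f\<^sub>n\<close> of arity \<open>n\<close>.\<close>

definition S_sig :: "nat \<Rightarrow> unit sim_type" where
  "S_sig n = (if n = 1 then Map.empty else [() \<mapsto> n])"

definition proj_variety :: "nat \<Rightarrow> nat \<Rightarrow> (unit, 'a) algebra set" where
  "proj_variety n i = models (S_sig n) {(App () (map Var [1..<n+1]), Var i)}"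

definition S_var :: "nat \<Rightarrow> (unit, 'a) algebra set" where
  "S_var n = (if n = 1 then models (S_sig 1) {}
              else variety_join (S_sig n) (proj_variety n ` {1..n}))"

end

theory Submission
  imports Defs
begin

text \<open>A block \<open>B\<close> of a lattice tolerance is determined by the filter \<open>up B\<close> it generates, and every
  block containing all joins \<open>b \<squnion> b'\<close> generates the filter \<open>up B \<inter> up B'\<close>. This yields
  factorability for the join and the associativity and commutativity of the join of blocks; meets
  are dual, and an automorphism of finite order that preserves a tolerance also reflects it, hence
  permutes the blocks.

  Suppose that \<open>RLat m\<close> and \<open>RLat n\<close> are term equivalent. The rotation of \<open>RLat m\<close> becomes, on
  each \<open>D\<close> in \<open>RLat n\<close>, an automorphism \<open>s\<close> of \<open>D\<close> with \<open>s\<^sup>m = id\<close>. At a fixed point \<open>x\<close> of \<open>s\<close>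
  all operations of \<open>RLat m\<close> are idempotent, so \<open>x\<close> is fixed by every unary term and in particular
  by the rotation of \<open>D\<close>. Let \<open>D\<close> be the lattice of \<open>n\<close>-periodic sets of integers, rotated by the
  shift. Then \<open>s\<close> is the translation by some \<open>i\<close>. It fixes the set of multiples of \<open>gcd i n\<close>, so the
  shift does, whence \<open>i\<close> and \<open>n\<close> are coprime and \<open>s\<^sup>m = id\<close> gives \<open>n dvd m\<close>. In contrast, all binary
  terms act as projections on a member of \<open>S_var k\<close> with more than one element, so none of them
  is commutative.\<close>

section \<open>Blocks of lattice tolerances\<close>

locale lattice_on_set =
  fixes L :: "'a set" and j m :: "'a \<Rightarrow> 'a \<Rightarrow> 'a"
  assumes lattice: "lattice_on L j m"
begin

definition le :: "'a \<Rightarrow> 'a \<Rightarrow> bool" (infix "\<sqsubseteq>" 50) where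
  "x \<sqsubseteq> y \<longleftrightarrow> j x y = y"

lemma nonempty: "L \<noteq> {}"
  and j_closed: "x \<in> L \<Longrightarrow> y \<in> L \<Longrightarrow> j x y \<in> L"
  and m_closed: "x \<in> L \<Longrightarrow> y \<in> L \<Longrightarrow> m x y \<in> L"
  and j_commute: "x \<in> L \<Longrightarrow> y \<in> L \<Longrightarrow> j x y = j y x"
  and m_commute: "x \<in> L \<Longrightarrow> y \<in> L \<Longrightarrow> m x y = m y x"
  and j_assoc: "x \<in> L \<Longrightarrow> y \<in> L \<Longrightarrow> z \<in> L \<Longrightarrow> j (j x y) z = j x (j y z)"
  and m_assoc: "x \<in> L \<Longrightarrow> y \<in> L \<Longrightarrow> z \<in> L \<Longrightarrow> m (m x y) z = m x (m y z)"
  and j_absorb: "x \<in> L \<Longrightarrow> y \<in> L \<Longrightarrow> j x (m x y) = x"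
  and m_absorb: "x \<in> L \<Longrightarrow> y \<in> L \<Longrightarrow> m x (j x y) = x"
  using lattice unfolding lattice_on_def by blast+

lemma dual_lattice: "lattice_on L m j"
  using lattice unfolding lattice_on_def by blast

lemma j_idem: "x \<in> L \<Longrightarrow> j x x = x"
  by (metis j_absorb j_closed m_absorb)

lemma le_refl: "x \<in> L \<Longrightarrow> x \<sqsubseteq> x"
  by (simp add: le_def j_idem)

lemma le_trans: "x \<in> L \<Longrightarrow> y \<in> L \<Longrightarrow> z \<in> L \<Longrightarrow> x \<sqsubseteq> y \<Longrightarrow> y \<sqsubseteq> z \<Longrightarrow> x \<sqsubseteq> z"
  unfolding le_def by (metis j_assoc)

lemma le_iff_m: "x \<in> L \<Longrightarrow> y \<in> L \<Longrightarrow> x \<sqsubseteq> y \<longleftrightarrow> m x y = x"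
  unfolding le_def by (metis j_absorb j_commute m_absorb m_commute m_closed)

lemma le_j1: "x \<in> L \<Longrightarrow> y \<in> L \<Longrightarrow> x \<sqsubseteq> j x y"
  unfolding le_def by (metis j_assoc j_idem)

lemma le_j2: "x \<in> L \<Longrightarrow> y \<in> L \<Longrightarrow> y \<sqsubseteq> j x y"
  by (metis le_j1 j_commute)

lemma j_least: "x \<in> L \<Longrightarrow> y \<in> L \<Longrightarrow> z \<in> L \<Longrightarrow> x \<sqsubseteq> z \<Longrightarrow> y \<sqsubseteq> z \<Longrightarrow> j x y \<sqsubseteq> z"
  unfolding le_def by (metis j_assoc)

lemma m_le1: "x \<in> L \<Longrightarrow> y \<in> L \<Longrightarrow> m x y \<sqsubseteq> x"
  unfolding le_def by (metis j_absorb j_commute m_closed)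

lemma m_le2: "x \<in> L \<Longrightarrow> y \<in> L \<Longrightarrow> m x y \<sqsubseteq> y"
  by (metis m_le1 m_commute)

end

section \<open>Tolerances of a lattice and their blocks\<close>

locale lattice_tolerance = lattice_on_set +
  fixes T
  assumes T_refl: "x \<in> L \<Longrightarrow> (x, x) \<in> T"
    and T_sym: "(x, y) \<in> T \<Longrightarrow> (y, x) \<in> T"
    and T_j: "x \<in> L \<Longrightarrow> y \<in> L \<Longrightarrow> x' \<in> L \<Longrightarrow> y' \<in> L \<Longrightarrow>
      (x, x') \<in> T \<Longrightarrow> (y, y') \<in> T \<Longrightarrow> (j x y, j x' y') \<in> T"
    and T_m: "x \<in> L \<Longrightarrow> y \<in> L \<Longrightarrow> x' \<in> L \<Longrightarrow> y' \<in> L \<Longrightarrow>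
      (x, x') \<in> T \<Longrightarrow> (y, y') \<in> T \<Longrightarrow> (m x y, m x' y') \<in> T"
begin

definition blocks :: "'a set set" where
  "blocks = {B. B \<subseteq> L \<and> B \<times> B \<subseteq> T \<and> (\<forall>C. B \<subseteq> C \<and> C \<subseteq> L \<and> C \<times> C \<subseteq> T \<longrightarrow> C = B)}"

definition up :: "'a set \<Rightarrow> 'a set" where
  "up B = {x\<in>L. \<exists>b\<in>B. b \<sqsubseteq> x}"

lemma blockD: "B \<in> blocks \<Longrightarrow> x \<in> B \<Longrightarrow> x \<in> L"
  and block_T: "B \<in> blocks \<Longrightarrow> x \<in> B \<Longrightarrow> y \<in> B \<Longrightarrow> (x, y) \<in> T"
  unfolding blocks_def by blast+

text \<open>Joining \<open>(u, v)\<close> with \<open>x\<close> gives \<open>(x, v)\<close>, and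
  joining \<open>(v, u)\<close> with \<open>y\<close> gives \<open>(v, y)\<close>. The meet of these
  two pairs is \<open>(x, y)\<close>.\<close>

lemma interval_T:
  assumes uv: "(u, v) \<in> T" and L: "u \<in> L" "v \<in> L" "x \<in> L" "y \<in> L"
    and le: "u \<sqsubseteq> x" "x \<sqsubseteq> v" "u \<sqsubseteq> y" "y \<sqsubseteq> v"
  shows "(x, y) \<in> T"
proof -
  have "(j u x, j v x) \<in> T" "(j v y, j u y) \<in> T"
    using L by (auto intro: T_j uv T_sym[OF uv] T_refl)
  then have "(x, v) \<in> T" "(v, y) \<in> T"
    using le L by (metis le_def j_commute)+
  then have "(m x v, m v y) \<in> T"
    using L by (auto intro: T_m)
  then show ?thesis
    using le L by (metis le_iff_m m_commute)
qed

lemma block_memI: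
  assumes "B \<in> blocks" "u \<in> L" "\<And>b. b \<in> B \<Longrightarrow> (u, b) \<in> T"
  shows "u \<in> B"
proof -
  \<comment> \<open>Enlarging \<open>B\<close> by \<open>u\<close> keeps its elements pairwise
    related, so maximality forces \<open>u\<close> into \<open>B\<close>.\<close>
  have "(b, c) \<in> T" if "b \<in> insert u B" "c \<in> insert u B" for b c
    using that assms block_T T_refl T_sym by blast
  then have "insert u B \<subseteq> L" "insert u B \<times> insert u B \<subseteq> T"
    using assms(1,2) blockD by blast+
  then have "insert u B = B"
    using assms(1) unfolding blocks_def by blast
  then show ?thesis by blast
qed

lemma ex_block:
  assumes "X \<subseteq> L" "X \<times> X \<subseteq> T"
  shows "\<exists>B\<in>blocks. X \<subseteq> B"
proof -
  define S where "S = {C. X \<subseteq> C \<and> C \<subseteq> L \<and> C \<times> C \<subseteq> T}"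
  have "\<exists>B\<in>S. \<forall>C\<in>S. B \<subseteq> C \<longrightarrow> C = B"
  proof (rule subset_Zorn_nonempty)
    show "S \<noteq> {}"
      using assms unfolding S_def by blast
  next
    fix \<C> assume "\<C> \<noteq> {}" "subset.chain S \<C>"
    then have ne: "\<C> \<noteq> {}" and sub: "\<C> \<subseteq> S"
      and chain: "\<And>C D. C \<in> \<C> \<Longrightarrow> D \<in> \<C> \<Longrightarrow> C \<subseteq> D \<or> D \<subseteq> C"
      unfolding subset_chain_def by auto
    have "(x, y) \<in> T" if xy: "C \<in> \<C>" "D \<in> \<C>" "x \<in> C" "y \<in> D" for C D x y
    proof -
      obtain E where "E \<in> \<C>" "x \<in> E" "y \<in> E"
        using chain[OF xy(1,2)] xy by blast
      moreover from this have "E \<times> E \<subseteq> T"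
        using sub unfolding S_def by blast
      ultimately show ?thesis by blast
    qed
    then have "\<Union>\<C> \<times> \<Union>\<C> \<subseteq> T"
      by blast
    moreover have "\<Union>\<C> \<subseteq> L"
      using sub unfolding S_def by blast
    moreover have "X \<subseteq> \<Union>\<C>"
      using ne sub unfolding S_def by blast
    ultimately show "\<Union>\<C> \<in> S"
      unfolding S_def by blast
  qed
  then obtain B where B: "B \<in> S" "\<And>C. C \<in> S \<Longrightarrow> B \<subseteq> C \<Longrightarrow> C = B"
    by blast
  then have X: "X \<subseteq> B" and "B \<subseteq> L" "B \<times> B \<subseteq> T"
    unfolding S_def by simp_all
  moreover have "C = B" if "B \<subseteq> C" "C \<subseteq> L" "C \<times> C \<subseteq> T" for C
    using B(2)[of C] that X by (simp add: S_def)
  ultimately have "B \<in> blocks"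
    by (auto simp: blocks_def)
  with X show ?thesis by blast
qed

lemma ex_block_containing: "x \<in> L \<Longrightarrow> \<exists>B\<in>blocks. x \<in> B"
  using ex_block[of "{x}"] T_refl by auto

lemma block_nonempty:
  assumes "B \<in> blocks"
  shows "B \<noteq> {}"
  \<comment> \<open>For empty \<open>B\<close> the condition in \<open>block_memI\<close> is
    vacuous, so every element of \<open>L\<close> would lie in \<open>B\<close>.\<close>
  using block_memI[OF assms] nonempty by auto

lemma block_j:
  assumes "B \<in> blocks" "a \<in> B" "b \<in> B"
  shows "j a b \<in> B"
proof (rule block_memI[OF assms(1)])
  show "(j a b, c) \<in> T" if "c \<in> B" for c
    using T_j[of a b c c] j_idem[of c] that assms blockD block_T by metis
qed (use assms blockD j_closed in blast)

text \<open>Swapping \<open>j\<close> and \<open>m\<close> changes neither \<open>T\<close> nor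
  \<open>blocks\<close>, so interpreting the locale at the dual lattice turns each result on joins
  into one on meets.\<close>

lemma dual_lattice_tolerance: "lattice_tolerance L m j T"
  by unfold_locales (use dual_lattice T_refl T_sym T_j T_m in blast)+

end

context lattice_tolerance
begin

interpretation dual: lattice_tolerance L m j T
  by (rule dual_lattice_tolerance)

lemma dual_le: "x \<in> L \<Longrightarrow> y \<in> L \<Longrightarrow> dual.le x y \<longleftrightarrow> y \<sqsubseteq> x"
  by (metis dual.le_def le_iff_m m_commute)

lemma block_m: "B \<in> blocks \<Longrightarrow> a \<in> B \<Longrightarrow> b \<in> B \<Longrightarrow> m a b \<in> B"
  using dual.block_j by simp

text \<open>For any \<open>c\<close> in \<open>B\<close>, both \<open>x\<close> and \<open>c\<close>
  lie in the interval from \<open>m a c\<close> to \<open>j b c\<close>. Its ends belong to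
  \<open>B\<close>, so they are related and \<open>interval_T\<close> applies.\<close>

lemma block_convex:
  assumes B: "B \<in> blocks" "a \<in> B" "b \<in> B" and x: "x \<in> L" "a \<sqsubseteq> x" "x \<sqsubseteq> b"
  shows "x \<in> B"
proof (rule block_memI[OF B(1) x(1)])
  fix c assume c: "c \<in> B"
  have L: "a \<in> L" "b \<in> L" "c \<in> L"
    using B c blockD by blast+
  have "(m a c, j b c) \<in> T"
    by (rule block_T[OF B(1) block_m[OF B(1,2) c] block_j[OF B(1,3) c]])
  then show "(x, c) \<in> T"
  proof (rule interval_T)
    show "m a c \<sqsubseteq> x" "x \<sqsubseteq> j b c"
      using L x m_le1 le_j1 le_trans m_closed j_closed by metis+
  qed (use L x m_closed j_closed m_le2 le_j2 in auto)
qed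

text \<open>If the filters agree, then below each element of one block there is an element of the
  other. Descending alternately relates every \<open>c\<close> in \<open>C\<close> to every
  \<open>d\<close> in \<open>D\<close>, and maximality then makes the blocks equal.\<close>

lemma up_inj:
  assumes C: "C \<in> blocks" and D: "D \<in> blocks" and eq: "up C = up D"
  shows "C = D"
proof -
  have below: "\<exists>y\<in>E. y \<sqsubseteq> x" if "E \<in> blocks" "E' \<in> blocks" "up E = up E'" "x \<in> E'" for x E E'
    using that le_refl blockD unfolding up_def by blast
  have T: "(c, d) \<in> T" if cd: "c \<in> C" "d \<in> D" for c d
  proof -
    \<comment> \<open>The descent ends with \<open>c1\<close> below both \<open>c\<close> and
      \<open>d\<close>. It is related to \<open>c\<close> inside the block \<open>C\<close>, and to
      \<open>d\<close> because it lies between \<open>d2\<close> and \<open>d\<close> in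
      \<open>D\<close>. Hence it is related to \<open>j c d\<close>, and the interval from
      \<open>c1\<close> to \<open>j c d\<close> contains \<open>c\<close> and
      \<open>d\<close>.\<close>
    obtain d1 where d1: "d1 \<in> D" "d1 \<sqsubseteq> c"
      using below D C eq cd by metis
    obtain c1 where c1: "c1 \<in> C" "c1 \<sqsubseteq> m d1 d"
      using below[OF C D eq] block_m D d1 cd by metis
    obtain d2 where d2: "d2 \<in> D" "d2 \<sqsubseteq> c1"
      using below D C eq c1 by metis
    have L: "c \<in> L" "d \<in> L" "c1 \<in> L" "d1 \<in> L" "d2 \<in> L"
      using C D cd d1 c1 d2 blockD by blast+
    have le: "c1 \<sqsubseteq> c" "c1 \<sqsubseteq> d"
      using c1 d1 L m_le1 m_le2 le_trans m_closed by metis+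
    have "(c1, d) \<in> T"
      using interval_T[of d2 d c1 d] block_T D d2 cd L le le_refl le_trans by metis
    moreover have "(c1, c) \<in> T"
      using block_T C c1 cd by blast
    ultimately have "(c1, j c d) \<in> T"
      using T_j[of c1 c1 c d] j_idem L by simp
    then show ?thesis
      using interval_T[of c1 "j c d" c d] L le le_j1 le_j2 j_closed by simp
  qed
  have "D \<subseteq> C"
    using T T_sym C D block_memI blockD by blast
  moreover have "C \<subseteq> D"
    using T C D block_memI blockD by blast
  ultimately show ?thesis by blast
qed

section \<open>The join of two blocks\<close>

lemma meet_mem_block:
  assumes B: "B \<in> blocks" "B' \<in> blocks" and C: "C \<in> blocks"
    and j: "\<And>b b'. b \<in> B \<Longrightarrow> b' \<in> B' \<Longrightarrow> j b b' \<in> C"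
    and c: "c \<in> C" and x: "x \<in> B"
  shows "m c x \<in> B"
proof (rule block_memI[OF B(1)])
  have cx: "c \<in> L" "x \<in> L"
    using c x C B blockD by blast+
  then show "m c x \<in> L"
    by (rule m_closed)
  fix b assume b: "b \<in> B"
  obtain y where y: "y \<in> B'"
    using B block_nonempty by blast
  \<comment> \<open>Replacing \<open>b\<close> by \<open>b1 \<ge> x\<close> makes \<open>b1\<close> related to \<open>c \<sqinter> x\<close>, since \<open>b1 = (b1 \<squnion> y) \<sqinter> b1\<close>
    and \<open>c\<close> is related to \<open>b1 \<squnion> y\<close>; convexity then brings back \<open>b\<close>.\<close>
  define b1 where "b1 = j b x"
  have b1: "b1 \<in> B"
    unfolding b1_def using block_j B b x by blast
  have L: "y \<in> L" "b \<in> L" "b1 \<in> L"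
    using b b1 y B blockD by blast+
  have "(c, j b1 y) \<in> T"
    using block_T C c j b1 y by blast
  then have "(m c b1, m (j b1 y) b1) \<in> T"
    by (rule T_m[OF cx(1) L(3) j_closed[OF L(3,1)] L(3) _ T_refl[OF L(3)]])
  then have "(m c b1, b1) \<in> T"
    using L m_absorb m_commute j_closed by metis
  moreover have "(x, b1) \<in> T" "(b, b1) \<in> T"
    using block_T B x b b1 by blast+
  ultimately have "(m (m c b1) x, m b1 b1) \<in> T" "(m (m (m c b1) x) b, m (m b1 b1) b1) \<in> T"
    using cx L by (auto intro!: T_m m_closed)
  moreover have "m b1 x = x"
    unfolding b1_def using cx L le_j2 le_iff_m j_closed m_commute by metis
  then have "m (m c b1) x = m c x"
    using cx L m_assoc by simp
  ultimately have "(m (m c x) b, b1) \<in> T"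
    using L dual.j_idem by simp
  then show "(m c x, b) \<in> T"
  proof (rule interval_T)
    show "m c x \<sqsubseteq> b1"
      unfolding b1_def using cx L m_le2 le_j2 le_trans m_closed j_closed by metis
    show "b \<sqsubseteq> b1"
      unfolding b1_def using cx L le_j1 by blast
  qed (use cx L m_closed m_le1 m_le2 in auto)
qed

text \<open>By \<open>meet_mem_block\<close> every \<open>c\<close> in \<open>C\<close> has the
  element \<open>m c e\<close> of \<open>B\<close> below it, and symmetrically one of
  \<open>B'\<close>. Conversely, an element above \<open>b\<close> and \<open>b'\<close> is above
  \<open>j b b'\<close>, which lies in \<open>C\<close>.\<close>

lemma up_join:
  assumes B: "B \<in> blocks" "B' \<in> blocks" and C: "C \<in> blocks"
    and j: "\<And>b b'. b \<in> B \<Longrightarrow> b' \<in> B' \<Longrightarrow> j b b' \<in> C"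
  shows "up C = up B \<inter> up B'"
proof -
  have sub: "up C \<subseteq> up E"
    if E: "E \<in> blocks" "E' \<in> blocks" "\<And>b b'. b \<in> E \<Longrightarrow> b' \<in> E' \<Longrightarrow> j b b' \<in> C" for E E'
  proof
    fix x assume "x \<in> up C"
    then obtain c where c: "x \<in> L" "c \<in> C" "c \<sqsubseteq> x"
      unfolding up_def by blast
    obtain e where e: "e \<in> E" using E block_nonempty by blast
    have "m c e \<in> E"
      using meet_mem_block[OF E(1,2) C E(3) c(2) e] .
    moreover have "m c e \<sqsubseteq> x"
      using c e E C blockD m_le1 le_trans m_closed by metis
    ultimately show "x \<in> up E"
      using c unfolding up_def by blast
  qed
  have "j b' b \<in> C" if "b' \<in> B'" "b \<in> B" for b b'
    using j that j_commute B blockD by metis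
  then have "up C \<subseteq> up B" "up C \<subseteq> up B'"
    using sub B j by blast+
  moreover have "up B \<inter> up B' \<subseteq> up C"
  proof
    fix x assume "x \<in> up B \<inter> up B'"
    then obtain b b' where "x \<in> L" "b \<in> B" "b' \<in> B'" "b \<sqsubseteq> x" "b' \<sqsubseteq> x"
      unfolding up_def by blast
    then show "x \<in> up C"
      using j j_least B blockD unfolding up_def by blast
  qed
  ultimately show ?thesis by blast
qed

text \<open>The joins are pairwise related, so some block contains them. By \<open>up_join\<close>
  its filter does not depend on the choice of that block, and \<open>up_inj\<close> gives
  uniqueness.\<close>

lemma ex1_block_join:
  assumes B: "B \<in> blocks" "B' \<in> blocks"
  shows "\<exists>!C. C \<in> blocks \<and> {j b b' |b b'. b \<in> B \<and> b' \<in> B'} \<subseteq> C"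
proof (rule ex_ex1I)
  have "\<exists>C\<in>blocks. {j b b' |b b'. b \<in> B \<and> b' \<in> B'} \<subseteq> C"
  proof (rule ex_block)
    show "{j b b' |b b'. b \<in> B \<and> b' \<in> B'} \<times> {j b b' |b b'. b \<in> B \<and> b' \<in> B'} \<subseteq> T"
      by (auto intro!: T_j intro: blockD[OF B(1)] blockD[OF B(2)] block_T[OF B(1)] block_T[OF B(2)])
  qed (use j_closed B blockD in blast)
  then show "\<exists>C. C \<in> blocks \<and> {j b b' |b b'. b \<in> B \<and> b' \<in> B'} \<subseteq> C"
    by blast
next
  fix C D
  assume C: "C \<in> blocks \<and> {j b b' |b b'. b \<in> B \<and> b' \<in> B'} \<subseteq> C"
    and D: "D \<in> blocks \<and> {j b b' |b b'. b \<in> B \<and> b' \<in> B'} \<subseteq> D"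
  have "up E = up B \<inter> up B'"
    if "E \<in> blocks \<and> {j b b' |b b'. b \<in> B \<and> b' \<in> B'} \<subseteq> E" for E
  proof (rule up_join[OF B])
    show "j b b' \<in> E" if "b \<in> B" "b' \<in> B'" for b b'
      using \<open>E \<in> blocks \<and> _\<close> that by blast
  qed (use that in simp)
  then show "C = D"
    using up_inj[of C D] C D by simp
qed

definition block_join :: "'a set \<Rightarrow> 'a set \<Rightarrow> 'a set" where
  "block_join B B' = (THE C. C \<in> blocks \<and> {j b b' |b b'. b \<in> B \<and> b' \<in> B'} \<subseteq> C)"

lemma
  assumes "B \<in> blocks" "B' \<in> blocks"
  shows block_join_in_blocks: "block_join B B' \<in> blocks"
    and j_in_block_join: "b \<in> B \<Longrightarrow> b' \<in> B' \<Longrightarrow> j b b' \<in> block_join B B'"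
  using theI'[OF ex1_block_join[OF assms]] unfolding block_join_def by blast+

lemma up_block_join: "B \<in> blocks \<Longrightarrow> B' \<in> blocks \<Longrightarrow> up (block_join B B') = up B \<inter> up B'"
  by (rule up_join) (auto intro: block_join_in_blocks j_in_block_join)

lemma block_join_eqI:
  assumes "B \<in> blocks" "B' \<in> blocks" "C \<in> blocks" "\<And>b b'. b \<in> B \<Longrightarrow> b' \<in> B' \<Longrightarrow> j b b' \<in> C"
  shows "block_join B B' = C"
  using up_inj up_join[OF assms] up_block_join block_join_in_blocks assms by metis

lemma block_join_commute:
  "B \<in> blocks \<Longrightarrow> B' \<in> blocks \<Longrightarrow> block_join B B' = block_join B' B"
  by (rule up_inj) (auto simp: block_join_in_blocks up_block_join)

lemma block_join_assoc:
  "A \<in> blocks \<Longrightarrow> B \<in> blocks \<Longrightarrow> C \<in> blocks \<Longrightarrow>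
    block_join (block_join A B) C = block_join A (block_join B C)"
  by (rule up_inj) (auto simp: block_join_in_blocks up_block_join)

end

section \<open>Absorption and the lattice of blocks\<close>

context lattice_tolerance
begin

interpretation dual: lattice_tolerance L m j T
  by (rule dual_lattice_tolerance)

text \<open>Filters describe joins and ideals describe meets, so here the two descriptions must be
  linked. Each \<open>c\<close> in the meet block lies in the ideal of \<open>B\<close>, hence below
  some \<open>x\<close> in \<open>B\<close>. Then \<open>j b c\<close> lies between \<open>b\<close>
  and \<open>j b x\<close>, and convexity puts it in \<open>B\<close>.\<close>

lemma block_absorb:
  assumes B: "B \<in> blocks" "B' \<in> blocks"
  shows "block_join B (dual.block_join B B') = B"
proof (rule block_join_eqI)
  have M: "dual.block_join B B' \<in> blocks"
    using dual.block_join_in_blocks B by simp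
  then show "dual.block_join B B' \<in> blocks" .
  fix b c assume b: "b \<in> B" and c: "c \<in> dual.block_join B B'"
  have L: "b \<in> L" "c \<in> L"
    using b c B M blockD by blast+
  have "c \<in> dual.up B"
    using dual.up_block_join B c L dual.le_refl unfolding dual.up_def by blast
  then obtain x where x: "x \<in> B" "c \<sqsubseteq> x"
    unfolding dual.up_def using dual_le blockD B by blast
  have xL: "x \<in> L" using x B blockD by blast
  show "j b c \<in> B"
  proof (rule block_convex[OF B(1) b])
    show "j b x \<in> B" using block_j B b x by blast
    show "j b c \<sqsubseteq> j b x"
      using L xL x le_j1 le_j2 j_least le_trans j_closed by metis
  qed (use L j_closed le_j1 in auto)
qed (use B in auto)

end

context lattice_tolerance
begin

interpretation dual: lattice_tolerance L m j T
  by (rule dual_lattice_tolerance)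

lemma lattice_on_blocks: "lattice_on blocks block_join dual.block_join"
  unfolding lattice_on_def
proof (intro conjI ballI)
  show "blocks \<noteq> {}"
    using ex_block_containing nonempty by blast
qed (fact dual.block_join_in_blocks dual.block_join_commute dual.block_join_assoc dual.block_absorb
    block_join_in_blocks block_join_commute block_join_assoc block_absorb)+

end

section \<open>Quotients of rotational lattices\<close>

lemma all_rl_sig_iff:
  "(\<forall>f n. rl_sig f = Some n \<longrightarrow> Q f n) \<longleftrightarrow> Q Join 2 \<and> Q Meet 2 \<and> Q Rot 1"
proof (intro iffI allI impI)
  assume "\<forall>f n. rl_sig f = Some n \<longrightarrow> Q f n"
  then show "Q Join 2 \<and> Q Meet 2 \<and> Q Rot 1"
    by (simp add: rl_sig_def)
next
  fix f n
  assume "Q Join 2 \<and> Q Meet 2 \<and> Q Rot 1" "rl_sig f = Some n"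
  then show "Q f n"
    by (cases f) (simp_all add: rl_sig_def)
qed

lemma ball_tuples_1: "(\<forall>xs\<in>tuples X 1. P xs) \<longleftrightarrow> (\<forall>x\<in>X. P [x])"
  by (auto simp: tuples_Suc tuples_0)

lemma ball_tuples_2: "(\<forall>xs\<in>tuples X 2. P xs) \<longleftrightarrow> (\<forall>x\<in>X. \<forall>y\<in>X. P [x, y])"
  by (auto simp: numeral_2_eq_2 tuples_Suc tuples_0)

lemma compatible_rl_sig_iff:
  "compatible rl_sig A T \<longleftrightarrow>
    (\<forall>x\<in>carrier A. \<forall>y\<in>carrier A. \<forall>x'\<in>carrier A. \<forall>y'\<in>carrier A.
      (x, x') \<in> T \<longrightarrow> (y, y') \<in> T \<longrightarrow>
      (ops A Join [x, y], ops A Join [x', y']) \<in> T \<and> (ops A Meet [x, y], ops A Meet [x', y']) \<in> T) \<and>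
    (\<forall>x\<in>carrier A. \<forall>x'\<in>carrier A. (x, x') \<in> T \<longrightarrow> (ops A Rot [x], ops A Rot [x']) \<in> T)"
  unfolding compatible_def all_rl_sig_iff ball_tuples_1 ball_tuples_2
  by (auto simp: less_2_cases_iff)

lemma RLat_iff:
  "A \<in> RLat n \<longleftrightarrow>
    lattice_on (carrier A) (\<lambda>x y. ops A Join [x, y]) (\<lambda>x y. ops A Meet [x, y]) \<and>
    lattice_automorphism (carrier A) (\<lambda>x y. ops A Join [x, y]) (\<lambda>x y. ops A Meet [x, y])
      (\<lambda>x. ops A Rot [x]) \<and>
    (\<forall>x\<in>carrier A. ((\<lambda>x. ops A Rot [x]) ^^ n) x = x)"
  unfolding RLat_def Let_def mem_Collect_eq ..

section \<open>Automorphisms of finite order acting on blocks\<close>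

locale lattice_auto_tolerance = lattice_tolerance +
  fixes g :: "'a \<Rightarrow> 'a" and n :: nat
  assumes g_auto: "lattice_automorphism L j m g"
    and g_order: "x \<in> L \<Longrightarrow> (g ^^ n) x = x"
    and n_pos: "n \<ge> 1"
    and T_g: "x \<in> L \<Longrightarrow> y \<in> L \<Longrightarrow> (x, y) \<in> T \<Longrightarrow> (g x, g y) \<in> T"
begin

lemma g_closed: "x \<in> L \<Longrightarrow> g x \<in> L"
  and g_inj: "inj_on g L"
  and g_surj: "g ` L = L"
  using g_auto unfolding lattice_automorphism_def bij_betw_def by blast+

lemma g_join: "x \<in> L \<Longrightarrow> y \<in> L \<Longrightarrow> g (j x y) = j (g x) (g y)"
  and g_meet: "x \<in> L \<Longrightarrow> y \<in> L \<Longrightarrow> g (m x y) = m (g x) (g y)"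
  using g_auto unfolding lattice_automorphism_def by blast+

lemma funpow_T: "x \<in> L \<Longrightarrow> y \<in> L \<Longrightarrow> (x, y) \<in> T \<Longrightarrow> ((g ^^ k) x, (g ^^ k) y) \<in> T"
proof (induction k)
  case (Suc k)
  have "(g ^^ k) z \<in> L" if "z \<in> L" for z
    using that by (induction k) (auto intro: g_closed)
  with Suc show ?case
    using T_g by simp
qed simp

text \<open>On \<open>L\<close> the inverse of \<open>g\<close> is its power with exponent
  \<open>n - 1\<close>, which preserves \<open>T\<close> like every power of
  \<open>g\<close>.\<close>

lemma T_g_iff:
  assumes "x \<in> L" "y \<in> L"
  shows "(g x, g y) \<in> T \<longleftrightarrow> (x, y) \<in> T"
proof
  assume "(g x, g y) \<in> T"
  then have "((g ^^ (n - 1)) (g x), (g ^^ (n - 1)) (g y)) \<in> T"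
    using funpow_T g_closed assms by blast
  moreover have "(g ^^ (n - 1)) (g z) = z" if "z \<in> L" for z
    using g_order[OF that] n_pos by (metis Suc_diff_1 comp_apply funpow_Suc_right less_eq_Suc_le One_nat_def)
  ultimately show "(x, y) \<in> T"
    using assms by simp
qed (use T_g assms in blast)

lemma image_block:
  assumes B: "B \<in> blocks"
  shows "g ` B \<in> blocks"
proof -
  have BL: "B \<subseteq> L" and BT: "B \<times> B \<subseteq> T"
    using B unfolding blocks_def by auto
  have "C = g ` B" if C: "g ` B \<subseteq> C" "C \<subseteq> L" "C \<times> C \<subseteq> T" for C
  proof -
    \<comment> \<open>The preimage of \<open>C\<close> contains \<open>B\<close>, and its elements
      are pairwise related because \<open>g\<close> reflects \<open>T\<close>. Maximality of
      \<open>B\<close> gives \<open>D = B\<close>.\<close>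
    define D where "D = {x\<in>L. g x \<in> C}"
    have "C \<subseteq> g ` L"
      using C(2) g_surj by simp
    then have gD: "g ` D = C"
      unfolding D_def by auto
    have "B \<subseteq> D" "D \<subseteq> L"
      using BL C(1) unfolding D_def by auto
    moreover have "D \<times> D \<subseteq> T"
      using T_g_iff C(3) unfolding D_def by auto
    ultimately have "D = B"
      using B by (auto simp: blocks_def)
    then show ?thesis using gD by simp
  qed
  moreover have "g ` B \<subseteq> L"
    using BL g_closed by blast
  moreover have "g ` B \<times> g ` B \<subseteq> T"
    using BL BT T_g by blast
  ultimately show ?thesis
    by (simp add: blocks_def)
qed

lemma image_block_join:
  assumes B: "B \<in> blocks" "B' \<in> blocks"
  shows "g ` block_join B B' = block_join (g ` B) (g ` B')"
proof (rule sym, rule block_join_eqI)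
  show "j b b' \<in> g ` block_join B B'" if b: "b \<in> g ` B" "b' \<in> g ` B'" for b b'
  proof -
    obtain c c' where c: "c \<in> B" "c' \<in> B'" "b = g c" "b' = g c'"
      using b by blast
    then have "j b b' = g (j c c')"
      using B blockD g_join by metis
    then show ?thesis
      using j_in_block_join B c by blast
  qed
qed (use B image_block block_join_in_blocks in auto)

lemma image_block_order:
  assumes "B \<in> blocks"
  shows "((`) g ^^ n) B = B"
proof -
  have "((`) g ^^ k) B = (g ^^ k) ` B" for k
    by (induction k) (auto simp: image_comp)
  moreover have "(g ^^ n) ` B = id ` B"
    using g_order assms blockD by (intro image_cong) auto
  ultimately show ?thesis by simp
qed

lemma image_block_unique:
  assumes "B \<in> blocks" "C \<in> blocks" "g ` B \<subseteq> C"
  shows "C = g ` B"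
  using image_block[OF assms(1)] assms by (auto simp: blocks_def)

lemma dual_lattice_auto_tolerance: "lattice_auto_tolerance L m j T g n"
proof -
  interpret dual: lattice_tolerance L m j T
    by (rule dual_lattice_tolerance)
  show ?thesis
    by unfold_locales (use g_auto g_order n_pos T_g in \<open>auto simp: lattice_automorphism_def\<close>)
qed

end

context lattice_auto_tolerance
begin

interpretation dual: lattice_auto_tolerance L m j T g n
  by (rule dual_lattice_auto_tolerance)

lemma image_automorphism: "lattice_automorphism blocks block_join dual.block_join ((`) g)"
  unfolding lattice_automorphism_def
  using bij_betw_of_funpow_id[OF n_pos, of blocks "(`) g"]
  by (simp add: image_block image_block_order image_block_join dual.image_block_join)

end

lemma RLat_tolerance:
  assumes "A \<in> RLat n" "n \<ge> 1" "T \<in> Tol rl_sig A"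
  shows "lattice_auto_tolerance (carrier A) (\<lambda>x y. ops A Join [x, y]) (\<lambda>x y. ops A Meet [x, y]) T
    (\<lambda>x. ops A Rot [x]) n"
proof -
  have "T \<subseteq> carrier A \<times> carrier A" and refl: "refl_on (carrier A) T" and "sym T"
    and c: "compatible rl_sig A T"
    using assms(3) unfolding Tol_def by blast+
  then show ?thesis
    using assms(1,2) c[unfolded compatible_rl_sig_iff] unfolding RLat_iff
    by unfold_locales (auto dest: refl_onD symD)
qed

lemma complex_op_1: "complex_op A f [B] = (\<lambda>x. ops A f [x]) ` B"
  unfolding complex_op_def by (auto simp: list_all2_Cons2)

lemma complex_op_2: "complex_op A f [B, B'] = {ops A f [b, b'] |b b'. b \<in> B \<and> b' \<in> B'}"
  unfolding complex_op_def by (auto simp: list_all2_Cons2)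

theorem RLat_factorable_quotient:
  assumes A: "A \<in> RLat n" and n: "n \<ge> 1" and T: "T \<in> Tol rl_sig A"
  shows "factorable_by rl_sig A T" "quotient_alg A T \<in> RLat n"
proof -
  interpret lattice_auto_tolerance "carrier A" "\<lambda>x y. ops A Join [x, y]"
    "\<lambda>x y. ops A Meet [x, y]" T "\<lambda>x. ops A Rot [x]" n
    by (rule RLat_tolerance[OF A n T])
  interpret dual: lattice_auto_tolerance "carrier A" "\<lambda>x y. ops A Meet [x, y]"
    "\<lambda>x y. ops A Join [x, y]" T "\<lambda>x. ops A Rot [x]" n
    by (rule dual_lattice_auto_tolerance)
  have Block: "Block A T = blocks"
    unfolding Block_def blocks_def ..
  have ex1_rot: "\<exists>!C. C \<in> blocks \<and> (\<lambda>x. ops A Rot [x]) ` B \<subseteq> C" if "B \<in> blocks" for B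
    by (rule ex1I[of _ "(\<lambda>x. ops A Rot [x]) ` B"]) (use image_block image_block_unique that in auto)
  show "factorable_by rl_sig A T"
    unfolding factorable_by_def all_rl_sig_iff ball_tuples_1 ball_tuples_2 complex_op_1
      complex_op_2 Block
    by (intro conjI ballI; (rule ex1_block_join dual.ex1_block_join ex1_rot; assumption))
  define Q where "Q = quotient_alg A T"
  have car: "carrier Q = blocks"
    and join: "ops Q Join [B, B'] = block_join B B'"
    and meet: "ops Q Meet [B, B'] = dual.block_join B B'" for B B'
    unfolding Q_def quotient_alg_def block_join_def dual.block_join_def
    by (simp_all add: complex_op_2 Block)
  have rot: "ops Q Rot [B] = (\<lambda>x. ops A Rot [x]) ` B" if "B \<in> blocks" for B
    unfolding Q_def quotient_alg_def
    by (simp add: complex_op_1 Block)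
      (use the1_equality[OF ex1_rot[OF that]] image_block that in blast)
  \<comment> \<open>The rotation of \<open>Q\<close> is known to be the image map on blocks only, so
    the induction also carries membership in \<open>blocks\<close>.\<close>
  have pow: "((\<lambda>B. ops Q Rot [B]) ^^ k) B = ((`) (\<lambda>x. ops A Rot [x]) ^^ k) B \<and>
      ((`) (\<lambda>x. ops A Rot [x]) ^^ k) B \<in> blocks" if "B \<in> blocks" for B k
    using that by (induction k) (auto simp: rot image_block)
  have "lattice_automorphism blocks block_join dual.block_join (\<lambda>B. ops Q Rot [B])"
    using image_automorphism rot block_join_in_blocks dual.block_join_in_blocks
    by (simp add: lattice_automorphism_def cong: bij_betw_cong)
  then show "Q \<in> RLat n"
    unfolding RLat_iff car join meet using lattice_on_blocks pow image_block_order by simp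
qed

lemma strongly_tolerance_factorable_RLat:
  assumes "n \<ge> 1"
  shows "strongly_tolerance_factorable rl_sig (RLat n) (RLat n)"
  using RLat_factorable_quotient assms
  unfolding strongly_tolerance_factorable_def tolerance_factorable_def tolerance_factorable_alg_def
  by blast

section \<open>Proper tolerances and term functions\<close>

lemma RLatI:
  assumes "lattice_on L j m" "n \<ge> 1"
    and "\<And>x. x \<in> L \<Longrightarrow> g x \<in> L" "\<And>x. x \<in> L \<Longrightarrow> (g ^^ n) x = x"
    and "\<And>x y. x \<in> L \<Longrightarrow> y \<in> L \<Longrightarrow> g (j x y) = j (g x) (g y)"
    and "\<And>x y. x \<in> L \<Longrightarrow> y \<in> L \<Longrightarrow> g (m x y) = m (g x) (g y)"
  shows "\<lparr>carrier = L, ops = (\<lambda>f xs. case f of Join \<Rightarrow> j (xs ! 0) (xs ! 1)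
    | Meet \<Rightarrow> m (xs ! 0) (xs ! 1) | Rot \<Rightarrow> g (xs ! 0))\<rparr> \<in> RLat n"
  unfolding RLat_iff lattice_automorphism_def
  using assms bij_betw_of_funpow_id[of n L g] by simp

lemma is_algebra_RLat: "A \<in> RLat n \<Longrightarrow> is_algebra rl_sig A"
  unfolding is_algebra_rl_sig RLat_iff lattice_on_def lattice_automorphism_def
  by (auto dest: bij_betwE)

text \<open>The concrete examples live on \<open>nat\<close> and \<open>int set\<close>, while the
  theorem speaks of an arbitrary infinite type. An injection \<open>e\<close> carries them over;
  arguments are pulled back by \<open>inv_into\<close>, so the operations are meaningful on the
  image of the carrier.\<close>

definition iso_copy :: "('a \<Rightarrow> 'b) \<Rightarrow> ('f, 'a) algebra \<Rightarrow> ('f, 'b) algebra" where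
  "iso_copy e A =
    \<lparr>carrier = e ` carrier A, ops = (\<lambda>f xs. e (ops A f (map (inv_into (carrier A) e) xs)))\<rparr>"

lemma iso_copy_simps:
  "carrier (iso_copy e A) = e ` carrier A"
  "inj_on e (carrier A) \<Longrightarrow> set xs \<subseteq> carrier A \<Longrightarrow> ops (iso_copy e A) f (map e xs) = e (ops A f xs)"
proof -
  assume "inj_on e (carrier A)" "set xs \<subseteq> carrier A"
  then have "map (inv_into (carrier A) e) (map e xs) = xs"
    by (simp add: map_idI subset_iff)
  then show "ops (iso_copy e A) f (map e xs) = e (ops A f xs)"
    by (simp add: iso_copy_def)
qed (simp add: iso_copy_def)

lemma iso_copy_ops_1:
  "inj_on e (carrier A) \<Longrightarrow> x \<in> carrier A \<Longrightarrow> ops (iso_copy e A) f [e x] = e (ops A f [x])"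
  using iso_copy_simps(2)[of e A "[x]" f] by simp

lemma iso_copy_ops_2:
  "inj_on e (carrier A) \<Longrightarrow> x \<in> carrier A \<Longrightarrow> y \<in> carrier A \<Longrightarrow>
    ops (iso_copy e A) f [e x, e y] = e (ops A f [x, y])"
  using iso_copy_simps(2)[of e A "[x, y]" f] by simp

lemma iso_copy_RLat:
  assumes e: "inj_on e (carrier A)" and A: "A \<in> RLat n" and n: "n \<ge> 1"
  shows "iso_copy e A \<in> RLat n"
proof -
  interpret lattice_on_set "carrier A" "\<lambda>x y. ops A Join [x, y]" "\<lambda>x y. ops A Meet [x, y]"
    using A unfolding RLat_iff by unfold_locales blast
  note is_algebra_RLat[OF A, unfolded is_algebra_rl_sig]
  then have closed: "carrier A \<noteq> {}"
    "\<And>x y. x \<in> carrier A \<Longrightarrow> y \<in> carrier A \<Longrightarrow> ops A Join [x, y] \<in> carrier A"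
    "\<And>x y. x \<in> carrier A \<Longrightarrow> y \<in> carrier A \<Longrightarrow> ops A Meet [x, y] \<in> carrier A"
    "\<And>x. x \<in> carrier A \<Longrightarrow> ops A Rot [x] \<in> carrier A"
    by auto
  note [simp] = iso_copy_simps(1) iso_copy_ops_1[OF e] iso_copy_ops_2[OF e]
  have "lattice_on (carrier (iso_copy e A)) (\<lambda>x y. ops (iso_copy e A) Join [x, y])
      (\<lambda>x y. ops (iso_copy e A) Meet [x, y])"
    unfolding lattice_on_def
    by (auto simp: closed j_assoc m_assoc j_absorb m_absorb
        intro!: arg_cong[of _ _ e] j_commute m_commute)
  moreover have pow: "((\<lambda>x. ops (iso_copy e A) Rot [x]) ^^ k) (e x) = e (((\<lambda>x. ops A Rot [x]) ^^ k) x) \<and>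
      ((\<lambda>x. ops A Rot [x]) ^^ k) x \<in> carrier A"
    if "x \<in> carrier A" for k x
    using that by (induction k) (auto simp: closed)
  moreover have "bij_betw (\<lambda>x. ops (iso_copy e A) Rot [x]) (e ` carrier A) (e ` carrier A)"
    by (rule bij_betw_of_funpow_id[OF n]) (use A pow closed in \<open>auto simp: RLat_iff\<close>)
  ultimately show ?thesis
    using A closed unfolding RLat_iff lattice_automorphism_def by simp
qed

text \<open>The chain of natural numbers with the identity as rotation lies in
  \<open>RLat n\<close>. Having distance at most 1 is preserved by \<open>max\<close> and
  \<open>min\<close>, but 0, 1, 2 show that it is not transitive.\<close>

lemma has_proper_tolerances_RLat:
  assumes inf: "infinite (UNIV :: 'u set)" and n: "n \<ge> 1"
  shows "has_proper_tolerances rl_sig (RLat n :: (rl_symbol, 'u) algebra set)"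
proof -
  obtain e :: "nat \<Rightarrow> 'u" where e: "inj e"
    using inf infinite_countable_subset by blast
  define C :: "(rl_symbol, nat) algebra" where
    "C = \<lparr>carrier = UNIV, ops = (\<lambda>f xs. case f of Join \<Rightarrow> max (xs ! 0) (xs ! 1)
      | Meet \<Rightarrow> min (xs ! 0) (xs ! 1) | Rot \<Rightarrow> id (xs ! 0))\<rparr>"
  have C: "C \<in> RLat n"
    unfolding C_def by (rule RLatI[where g = id]) (use n in \<open>auto simp: lattice_on_def\<close>)
  have ops: "carrier C = UNIV" "ops C Join [x, y] = max x y" "ops C Meet [x, y] = min x y"
    "ops C Rot [x] = x" for x y
    by (simp_all add: C_def)
  define A where "A = iso_copy e C"
  define T where "T = {(e i, e k) |i k. i \<le> Suc k \<and> k \<le> Suc i}"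
  have A: "A \<in> RLat n"
    unfolding A_def by (rule iso_copy_RLat) (use e C n ops in auto)
  have A_simps: "carrier A = range e" "ops A Join [e i, e k] = e (max i k)"
    "ops A Meet [e i, e k] = e (min i k)" "ops A Rot [e i] = e i" for i k
    unfolding A_def using e by (simp_all add: iso_copy_simps(1) iso_copy_ops_1 iso_copy_ops_2 ops)
  have T_iff: "(e i, e k) \<in> T \<longleftrightarrow> i \<le> Suc k \<and> k \<le> Suc i" for i k
    using e unfolding T_def by (auto dest: injD)
  have "compatible rl_sig A T"
    unfolding compatible_rl_sig_iff A_simps(1) by (auto simp: A_simps(2-) T_iff)
  moreover have "refl_on (carrier A) T" "sym T" "T \<subseteq> carrier A \<times> carrier A"
    unfolding refl_on_def sym_def A_simps by (auto simp: T_iff) (auto simp: T_def)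
  ultimately have "T \<in> Tol rl_sig A"
    unfolding Tol_def by blast
  moreover have "\<not> congruence rl_sig A T"
  proof
    assume "congruence rl_sig A T"
    then have "trans T"
      unfolding congruence_def equiv_def by blast
    moreover have "(e 0, e 1) \<in> T" "(e 1, e 2) \<in> T" "(e 0, e 2) \<notin> T"
      by (simp_all add: T_iff)
    ultimately show False by (meson transD)
  qed
  ultimately show ?thesis
    using A unfolding has_proper_tolerances_def by blast
qed

section \<open>Term functions under endomorphisms and at idempotent elements\<close>

lemma eval_trm_closed:
  assumes "is_algebra \<Sigma> A" "wf_trm \<Sigma> t" "\<And>i. i \<in> vars t \<Longrightarrow> \<rho> i \<in> carrier A"
  shows "eval_trm A \<rho> t \<in> carrier A"
  using assms(2,3)
proof (induction t)
  case (App f ts)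
  have "map (eval_trm A \<rho>) ts \<in> tuples (carrier A) (length ts)"
    using App by (auto simp: tuples_def list_all_iff)
  then show ?case
    using assms(1) App.prems(1) by (auto simp: is_algebra_def)
qed simp

text \<open>Meant for \<open>h\<close> a rotation: it commutes with all basic operations, itself
  included, and therefore with every operation defined by a term, in particular with those of an
  equivalent algebra.\<close>

lemma eval_trm_commute:
  assumes A: "is_algebra \<Sigma> A"
    and h: "\<And>f k xs. \<Sigma> f = Some k \<Longrightarrow> xs \<in> tuples (carrier A) k \<Longrightarrow>
      h (ops A f xs) = ops A f (map h xs)"
    and "wf_trm \<Sigma> t" "\<And>i. i \<in> vars t \<Longrightarrow> \<rho> i \<in> carrier A \<and> \<rho>' i = h (\<rho> i)"
  shows "eval_trm A \<rho>' t = h (eval_trm A \<rho> t)"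
  using assms(3,4)
proof (induction t)
  case (App f ts)
  have "eval_trm A \<rho> t \<in> carrier A \<and> eval_trm A \<rho>' t = h (eval_trm A \<rho> t)" if "t \<in> set ts" for t
    using that App eval_trm_closed[OF A, of t \<rho>] by (auto simp: list_all_iff)
  then have "map (eval_trm A \<rho>) ts \<in> tuples (carrier A) (length ts)"
    and eq: "map (eval_trm A \<rho>') ts = map h (map (eval_trm A \<rho>) ts)"
    by (auto simp: tuples_def)
  then have "h (eval_trm A \<rho> (App f ts)) = ops A f (map h (map (eval_trm A \<rho>) ts))"
    using h[of f "length ts"] App.prems(1) by simp
  then show ?case
    by (simp only: eval_trm.simps eq)
qed simp

text \<open>The hypothesis makes \<open>{x}\<close> a subalgebra, so no term leads out of
  it.\<close>

lemma eval_trm_idem: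
  assumes "\<And>f k. \<Sigma> f = Some k \<Longrightarrow> ops A f (replicate k x) = x"
    and "wf_trm \<Sigma> t" "\<And>i. i \<in> vars t \<Longrightarrow> \<rho> i = x"
  shows "eval_trm A \<rho> t = x"
  using assms(2,3)
proof (induction t)
  case (App f ts)
  then have "map (eval_trm A \<rho>) ts = replicate (length ts) x"
    by (intro replicate_eqI) (auto simp: list_all_iff)
  then show ?case
    using assms(1) App.prems(1) by simp
qed simp

lemma term_equivalent_sym: "term_equivalent \<Sigma> V \<Delta> W \<Longrightarrow> term_equivalent \<Delta> W \<Sigma> V"
  unfolding term_equivalent_def by blast

lemma term_equivalent_RLat_automorphism:
  fixes D :: "(rl_symbol, 'a) algebra"
  assumes te: "term_equivalent rl_sig (RLat m :: (rl_symbol, 'a) algebra set) rl_sig (RLat n)"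
    and D: "D \<in> RLat n"
  obtains s where "bij_betw s (carrier D) (carrier D)"
    "\<And>f k xs. rl_sig f = Some k \<Longrightarrow> xs \<in> tuples (carrier D) k \<Longrightarrow>
      s (ops D f xs) = ops D f (map s xs)"
    "\<And>x. x \<in> carrier D \<Longrightarrow> (s ^^ m) x = x"
    "\<And>x. x \<in> carrier D \<Longrightarrow> s x = x \<Longrightarrow> ops D Rot [x] = x"
proof -
  obtain \<sigma> \<tau> where \<tau>: "interprets rl_sig rl_sig \<tau>"
    and D': "term_reduct \<sigma> D \<in> RLat m"
    and same: "same_algebra rl_sig (term_reduct \<tau> (term_reduct \<sigma> D)) D"
    using te D unfolding term_equivalent_def by blast
  \<comment> \<open>\<open>D'\<close> is \<open>D\<close> seen as a member of \<open>RLat m\<close>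
    on the same carrier, and \<open>s\<close> is its rotation. The operations of \<open>D\<close>
    are recovered by evaluating the terms \<open>\<tau> f\<close> in \<open>D'\<close>.\<close>
  define D' where "D' = term_reduct \<sigma> D"
  define s where "s = (\<lambda>x. ops D' Rot [x])"
  have car: "carrier D' = carrier D"
    by (simp add: D'_def term_reduct_def)
  have D'_RLat: "D' \<in> RLat m"
    using D' by (simp add: D'_def)
  have ops: "ops D f xs = eval_trm D' (\<lambda>i. xs ! i) (\<tau> f)"
    if "rl_sig f = Some k" "xs \<in> tuples (carrier D) k" for f k xs
    using same that unfolding same_algebra_def D'_def by (auto simp: term_reduct_def)
  have wf: "wf_trm rl_sig (\<tau> f)" "vars (\<tau> f) \<subseteq> {..<k}" if "rl_sig f = Some k" for f k
    using \<tau> that unfolding interprets_def by blast+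
  have s_ops: "s (ops D' f xs) = ops D' f (map s xs)"
    if "rl_sig f = Some k" "xs \<in> tuples (carrier D') k" for f k xs
  proof -
    have "\<forall>f k. rl_sig f = Some k \<longrightarrow> (\<forall>xs\<in>tuples (carrier D') k. s (ops D' f xs) = ops D' f (map s xs))"
      unfolding all_rl_sig_iff ball_tuples_1 ball_tuples_2
      using D'_RLat unfolding RLat_iff lattice_automorphism_def s_def by simp
    then show ?thesis using that by blast
  qed
  show thesis
  proof
    show "bij_betw s (carrier D) (carrier D)" "\<And>x. x \<in> carrier D \<Longrightarrow> (s ^^ m) x = x"
      using D'_RLat unfolding RLat_iff lattice_automorphism_def car s_def by blast+
    then have s_closed: "s x \<in> carrier D" if "x \<in> carrier D" for x
      using that bij_betwE by blast
    show "s (ops D f xs) = ops D f (map s xs)"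
      if f: "rl_sig f = Some k" and xs: "xs \<in> tuples (carrier D) k" for f k xs
    proof -
      have "map s xs \<in> tuples (carrier D) k"
        using xs s_closed by (auto simp: tuples_def)
      moreover have "eval_trm D' (\<lambda>i. map s xs ! i) (\<tau> f) = s (eval_trm D' (\<lambda>i. xs ! i) (\<tau> f))"
      proof (rule eval_trm_commute[OF is_algebra_RLat[OF D'_RLat] s_ops wf(1)[OF f]])
        fix i assume "i \<in> vars (\<tau> f)"
        then have "i < length xs"
          using wf(2)[OF f] xs by (auto simp: tuples_def)
        then show "xs ! i \<in> carrier D' \<and> map s xs ! i = s (xs ! i)"
          using xs car nth_mem by (auto simp: tuples_def)
      qed
      ultimately show ?thesis
        using ops f xs by simp
    qed
    show "ops D Rot [x] = x" if x: "x \<in> carrier D" "s x = x" for x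
    proof -
      interpret D': lattice_on_set "carrier D'" "\<lambda>x y. ops D' Join [x, y]" "\<lambda>x y. ops D' Meet [x, y]"
        using D'_RLat unfolding RLat_iff by unfold_locales blast
      interpret dual: lattice_on_set "carrier D'" "\<lambda>x y. ops D' Meet [x, y]" "\<lambda>x y. ops D' Join [x, y]"
        by unfold_locales (rule D'.dual_lattice)
      \<comment> \<open>Joins and meets are idempotent in any lattice; for \<open>Rot\<close> the
        claim is \<open>s x = x\<close>.\<close>
      have "\<forall>f k. rl_sig f = Some k \<longrightarrow> ops D' f (replicate k x) = x"
        unfolding all_rl_sig_iff
        using D'.j_idem dual.j_idem x car by (simp add: numeral_2_eq_2 s_def)
      moreover have "rl_sig Rot = Some 1"
        by (simp add: rl_sig_def)
      moreover note wf[OF this]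
      ultimately have "eval_trm D' (\<lambda>i. [x] ! i) (\<tau> Rot) = x"
        by (intro eval_trm_idem[of rl_sig]) auto
      moreover have "ops D Rot [x] = eval_trm D' (\<lambda>i. [x] ! i) (\<tau> Rot)"
        by (rule ops[of _ 1]) (use x in \<open>simp_all add: rl_sig_def tuples_def\<close>)
      ultimately show ?thesis by simp
    qed
  qed
qed

section \<open>Non-equivalence\<close>

definition periodic_sets :: "nat \<Rightarrow> int set set" where
  "periodic_sets n = {S. \<forall>x. x \<in> S \<longleftrightarrow> x mod int n \<in> S}"

text \<open>The translate \<open>S + 1\<close>; since all integers are allowed, it needs no
  reduction modulo \<open>n\<close>.\<close>

definition shift :: "int set \<Rightarrow> int set" where
  "shift S = {x. x - 1 \<in> S}"

lemma periodic_sets_cong: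
  assumes "S \<in> periodic_sets n" "x mod int n = y mod int n"
  shows "x \<in> S \<longleftrightarrow> y \<in> S"
proof -
  have "z \<in> S \<longleftrightarrow> z mod int n \<in> S" for z
    using assms(1) unfolding periodic_sets_def mem_Collect_eq by (rule spec)
  from this[of x] this[of y] show ?thesis
    using assms(2) by simp
qed

lemma periodic_setsI:
  assumes "\<And>x y. x mod int n = y mod int n \<Longrightarrow> x \<in> S \<Longrightarrow> y \<in> S"
  shows "S \<in> periodic_sets n"
  unfolding periodic_sets_def
proof (intro CollectI allI)
  show "x \<in> S \<longleftrightarrow> x mod int n \<in> S" for x
    using assms[of x "x mod int n"] assms[of "x mod int n" x] by auto
qed

lemma funpow_shift: "(shift ^^ k) S = {x. x - int k \<in> S}"
  by (induction k) (auto simp: shift_def algebra_simps)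

lemma shift_periodic: "S \<in> periodic_sets n \<Longrightarrow> (shift ^^ k) S \<in> periodic_sets n"
  unfolding funpow_shift
  by (rule periodic_setsI) (auto dest: periodic_sets_cong mod_diff_cong[OF _ refl, of _ _ _ "int k"])

lemma residue_class_periodic: "{x. x mod int n = c} \<in> periodic_sets n"
  by (rule periodic_setsI) simp

text \<open>Finiteness allows a copy of this lattice inside any infinite type. A periodic set is
  determined by its residues.\<close>

lemma finite_periodic_sets:
  assumes "n \<ge> 1"
  shows "finite (periodic_sets n)"
proof (rule finite_subset)
  show "periodic_sets n \<subseteq> (\<lambda>R. {x. x mod int n \<in> R}) ` Pow {0..<int n}"
  proof
    fix S assume S: "S \<in> periodic_sets n"
    have "S = {x. x mod int n \<in> S \<inter> {0..<int n}}"
      using S assms by (auto simp: periodic_sets_def)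
    then show "S \<in> (\<lambda>R. {x. x mod int n \<in> R}) ` Pow {0..<int n}"
      by blast
  qed
qed simp

definition periodic_alg :: "nat \<Rightarrow> (rl_symbol, int set) algebra" where
  "periodic_alg n = \<lparr>carrier = periodic_sets n, ops = (\<lambda>f xs. case f of Join \<Rightarrow> xs ! 0 \<union> xs ! 1
    | Meet \<Rightarrow> xs ! 0 \<inter> xs ! 1 | Rot \<Rightarrow> shift (xs ! 0))\<rparr>"

lemma periodic_alg_simps [simp]:
  "carrier (periodic_alg n) = periodic_sets n"
  "ops (periodic_alg n) Join [S, S'] = S \<union> S'"
  "ops (periodic_alg n) Meet [S, S'] = S \<inter> S'"
  "ops (periodic_alg n) Rot [S] = shift S"
  by (simp_all add: periodic_alg_def)

lemma periodic_alg_RLat: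
  assumes n: "n \<ge> 1"
  shows "periodic_alg n \<in> RLat n"
  unfolding periodic_alg_def
proof (rule RLatI[OF _ n])
  have "S \<union> S' \<in> periodic_sets n" "S \<inter> S' \<in> periodic_sets n"
    if "S \<in> periodic_sets n" "S' \<in> periodic_sets n" for S S'
    using that unfolding periodic_sets_def by blast+
  moreover have "{} \<in> periodic_sets n"
    by (simp add: periodic_sets_def)
  ultimately show "lattice_on (periodic_sets n) (\<union>) (\<inter>)"
    unfolding lattice_on_def by blast
  show "shift S \<in> periodic_sets n" if "S \<in> periodic_sets n" for S
    using shift_periodic[of S n 1] that by simp
  show "(shift ^^ n) S = S" if "S \<in> periodic_sets n" for S
    unfolding funpow_shift using periodic_sets_cong[OF that, of "_ - int n"] by simp
qed (auto simp: shift_def)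

text \<open>The hypothesis \<open>fix_s\<close> ties the order of \<open>s\<close> to that of the
  shift: without it the identity would be a counterexample for \<open>n > 1\<close>.\<close>

lemma automorphism_periodic_sets_order:
  assumes n: "n \<ge> 1"
    and bij: "bij_betw s (periodic_sets n) (periodic_sets n)"
    and un: "\<And>S S'. S \<in> periodic_sets n \<Longrightarrow> S' \<in> periodic_sets n \<Longrightarrow> s (S \<union> S') = s S \<union> s S'"
    and int: "\<And>S S'. S \<in> periodic_sets n \<Longrightarrow> S' \<in> periodic_sets n \<Longrightarrow> s (S \<inter> S') = s S \<inter> s S'"
    and sh: "\<And>S. S \<in> periodic_sets n \<Longrightarrow> s (shift S) = shift (s S)"
    and ord: "\<And>S. S \<in> periodic_sets n \<Longrightarrow> (s ^^ m) S = S"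
    and fix_s: "\<And>S. S \<in> periodic_sets n \<Longrightarrow> s S = S \<Longrightarrow> shift S = S"
  shows "n dvd m"
proof -
  let ?P = "periodic_sets n"
  \<comment> \<open>The residue classes are the atoms of the lattice, and the shift permutes them in
    a single cycle.\<close>
  define K where "K c = {x. x mod int n = c mod int n}" for c :: int
  have K: "K c \<in> ?P" for c
    unfolding K_def by (rule residue_class_periodic)
  have shift_K: "(shift ^^ k) (K c) = K (c + int k)" for k c
    unfolding funpow_shift K_def by (auto simp: mod_eq_dvd_iff algebra_simps)
  have s_closed: "s S \<in> ?P" if "S \<in> ?P" for S
    using bij that bij_betwE by blast
  have s_shift: "s ((shift ^^ k) S) = (shift ^^ k) (s S)" if "S \<in> ?P" for k S
    by (induction k) (use that in \<open>simp_all add: sh shift_periodic\<close>)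
  have empty: "{} \<in> ?P"
    by (simp add: periodic_sets_def)
  have s_empty: "s {} = {}"
  proof -
    \<comment> \<open>For a preimage \<open>S\<close> of the empty set,
      \<open>s {} = s ({} \<inter> S) = s {} \<inter> {}\<close>.\<close>
    obtain S where "S \<in> ?P" "s S = {}"
      using bij empty unfolding bij_betw_def by (metis imageE)
    then show ?thesis
      using int[OF empty, of S] by simp
  qed
  have s_nonempty: "s S \<noteq> {}" if "S \<in> ?P" "S \<noteq> {}" for S
    using bij empty s_empty that unfolding bij_betw_def by (metis inj_onD)

  obtain i where i: "i \<in> s (K 0)"
    using s_nonempty[OF K] unfolding K_def by blast
  have s_K0: "s (K 0) = K i"
  proof
    show "K i \<subseteq> s (K 0)"
      using periodic_sets_cong[OF s_closed[OF K]] i unfolding K_def by blast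
    show "s (K 0) \<subseteq> K i"
    proof
      fix a assume a: "a \<in> s (K 0)"
      \<comment> \<open>Translating \<open>i\<close> by \<open>k\<close> reaches \<open>a\<close>
        modulo \<open>n\<close>, so \<open>a\<close> lies in \<open>s (K (int k))\<close> as well as
        in \<open>s (K 0)\<close>. The classes \<open>K 0\<close> and \<open>K (int k)\<close>
        therefore overlap, which forces \<open>a\<close> and \<open>i\<close> to be
        congruent.\<close>
      define k where "k = nat ((a - i) mod int n)"
      have k: "int k = (a - i) mod int n"
        unfolding k_def using n by simp
      have "(a - int k) mod int n = i mod int n"
        unfolding k by (simp add: mod_diff_right_eq)
      then have "a \<in> (shift ^^ k) (s (K 0))"
        unfolding funpow_shift using periodic_sets_cong[OF s_closed[OF K]] i by blast
      then have "a \<in> s (K 0 \<inter> K (int k))"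
        using a s_shift[of "K 0" k, OF K] shift_K[of k 0] int[OF K K] by simp
      then have "K 0 \<inter> K (int k) \<noteq> {}"
        using s_empty by auto
      then have "int k mod int n = 0"
        unfolding K_def by auto
      then have "(a - i) mod int n = 0"
        unfolding k by simp
      then show "a \<in> K i"
        unfolding K_def by (simp add: mod_eq_dvd_iff dvd_eq_mod_eq_0)
    qed
  qed
  have s_K: "s (K c) = K (c + i)" for c
  proof -
    define k where "k = nat (c mod int n)"
    have k: "int k = c mod int n"
      unfolding k_def using n by simp
    have "K c = (shift ^^ k) (K 0)" "(shift ^^ k) (K i) = K (c + i)"
      unfolding shift_K k by (simp_all add: K_def mod_add_right_eq add.commute)
    then show ?thesis
      using s_shift[OF K] s_K0 by simp
  qed

  \<comment> \<open>The multiples of \<open>d\<close> form a union of residue classes modulo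
    \<open>n\<close> that translation by \<open>i\<close> maps to itself, so \<open>fix_s\<close>
    can be applied to \<open>W\<close>.\<close>
  define d where "d = gcd i (int n)"
  define W where "W = {x. d dvd x}"
  have d: "d dvd i" "d dvd int n"
    unfolding d_def by simp_all
  have dvd_cong: "d dvd x \<longleftrightarrow> d dvd y" if "x mod int n = y mod int n" for x y
    using that d(2) by (metis dvd_mod_iff)
  \<comment> \<open>Only binary unions are known to be preserved, so finite unions are reached by
    induction, starting from \<open>s_empty\<close>.\<close>
  have s_Union: "(\<Union>c\<in>C. K c) \<in> ?P \<and> s (\<Union>c\<in>C. K c) = (\<Union>c\<in>C. K (c + i))" if "finite C" for C
    using that
  proof induction
    case (insert c C)
    then have "s (K c \<union> (\<Union>c\<in>C. K c)) = K (c + i) \<union> (\<Union>c\<in>C. K (c + i))"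
      using un K s_K by simp
    moreover have "K c \<union> (\<Union>c\<in>C. K c) \<in> ?P"
      using insert K[of c] unfolding periodic_sets_def by blast
    ultimately show ?case by simp
  qed (simp add: empty s_empty)
  define C where "C = {c\<in>{0..<int n}. d dvd c}"
  \<comment> \<open>The case \<open>l = 0\<close> expresses \<open>W\<close> as a union of classes,
    and the case \<open>l = i\<close> identifies its image under \<open>s\<close>.\<close>
  have W: "(\<Union>c\<in>C. K (c + l)) = W" if "d dvd l" for l
  proof (intro equalityI subsetI)
    fix x assume "x \<in> (\<Union>c\<in>C. K (c + l))"
    then obtain c where "d dvd c" "x mod int n = (c + l) mod int n"
      unfolding C_def K_def by blast
    then show "x \<in> W"
      using dvd_cong that unfolding W_def by (metis dvd_add mem_Collect_eq)
  next
    fix x assume "x \<in> W"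
    define c where "c = (x - l) mod int n"
    have "d dvd c"
      using \<open>x \<in> W\<close> that d(2) unfolding c_def W_def by (simp add: dvd_mod_iff)
    then have "c \<in> C"
      unfolding C_def c_def using n by simp
    moreover have "x \<in> K (c + l)"
      unfolding K_def c_def by (simp add: mod_add_left_eq)
    ultimately show "x \<in> (\<Union>c\<in>C. K (c + l))" by blast
  qed
  have "finite C"
    unfolding C_def by (rule finite_subset[of _ "{0..<int n}"]) auto
  then have "W \<in> ?P" "s W = W"
    using s_Union[of C] W[of 0] W[OF d(1)] by simp_all
  then have "shift W = W"
    by (rule fix_s)
  \<comment> \<open>Since 0 lies in \<open>W\<close>, 1 lies in \<open>shift W = W\<close>, that is,
    \<open>d\<close> divides 1.\<close>
  moreover have "1 \<in> shift W"
    unfolding shift_def W_def by simp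
  ultimately have "coprime (int n) i"
    unfolding W_def d_def by (simp add: coprime_iff_gcd_eq_1 gcd.commute)
  moreover have "(s ^^ k) (K 0) = K (int k * i)" for k
    by (induction k) (simp_all add: s_K algebra_simps)
  then have "K (int m * i) = K 0"
    using ord[OF K] by metis
  then have "0 \<in> K (int m * i)"
    unfolding K_def by simp
  then have "int n dvd int m * i"
    unfolding K_def by (simp add: dvd_eq_mod_eq_0)
  ultimately have "int n dvd int m"
    by (simp add: coprime_dvd_mult_left_iff)
  then show ?thesis by simp
qed

section \<open>Divisibility of the orders of term equivalent varieties\<close>

lemma RLat_term_equivalent_imp_dvd:
  assumes inf: "infinite (UNIV :: 'u set)" and n: "n \<ge> 1"
    and te: "term_equivalent rl_sig (RLat m :: (rl_symbol, 'u) algebra set) rl_sig (RLat n)"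
  shows "n dvd m"
proof -
  let ?P = "periodic_sets n"
  \<comment> \<open>A finite subset of \<open>'u\<close> of the right size provides the injection
    \<open>e\<close>.\<close>
  obtain B :: "'u set" where "finite B" "card B = card ?P"
    using infinite_arbitrarily_large[OF inf] by blast
  then obtain e :: "int set \<Rightarrow> 'u" where e: "inj_on e ?P"
    using finite_same_card_bij[OF finite_periodic_sets[OF n]] bij_betw_imp_inj_on by metis
  define D where "D = iso_copy e (periodic_alg n)"
  have e': "inj_on e (carrier (periodic_alg n))"
    using e by simp
  have car: "carrier D = e ` ?P"
    by (simp add: D_def iso_copy_simps(1))
  have D: "D \<in> RLat n"
    unfolding D_def by (rule iso_copy_RLat[OF e' periodic_alg_RLat[OF n] n])
  have closed: "S \<union> S' \<in> ?P" "S \<inter> S' \<in> ?P" "shift S \<in> ?P" if "S \<in> ?P" "S' \<in> ?P" for S S'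
    using that is_algebra_RLat[OF periodic_alg_RLat[OF n]] unfolding is_algebra_rl_sig by simp_all
  have ops: "ops D Join [e S, e S'] = e (S \<union> S')" "ops D Meet [e S, e S'] = e (S \<inter> S')"
    "ops D Rot [e S] = e (shift S)" if "S \<in> ?P" "S' \<in> ?P" for S S'
    unfolding D_def using that by (simp_all add: iso_copy_ops_1[OF e'] iso_copy_ops_2[OF e'])
  obtain t where t: "bij_betw t (carrier D) (carrier D)"
    "\<And>f k xs. rl_sig f = Some k \<Longrightarrow> xs \<in> tuples (carrier D) k \<Longrightarrow>
      t (ops D f xs) = ops D f (map t xs)"
    "\<And>x. x \<in> carrier D \<Longrightarrow> (t ^^ m) x = x"
    "\<And>x. x \<in> carrier D \<Longrightarrow> t x = x \<Longrightarrow> ops D Rot [x] = x"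
    using term_equivalent_RLat_automorphism[OF te D] by metis
  have t_ops: "t (ops D Join [x, y]) = ops D Join [t x, t y]"
    "t (ops D Meet [x, y]) = ops D Meet [t x, t y]" "t (ops D Rot [x]) = ops D Rot [t x]"
    if "x \<in> carrier D" "y \<in> carrier D" for x y
    using t(2)[of Join 2 "[x, y]"] t(2)[of Meet 2 "[x, y]"] t(2)[of Rot 1 "[x]"] that
    by (simp_all add: rl_sig_def tuples_def)
  \<comment> \<open>The automorphism \<open>t\<close> of the copy is conjugated back to the periodic
    sets.\<close>
  define s where "s = inv_into ?P e \<circ> t \<circ> e"
  have be: "bij_betw e ?P (carrier D)"
    using e car by (simp add: bij_betw_def)
  have bs: "bij_betw s ?P ?P"
    unfolding s_def comp_assoc
    by (rule bij_betw_trans[OF bij_betw_trans[OF be t(1)] bij_betw_inv_into[OF be]])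
  have s_closed: "s S \<in> ?P" if "S \<in> ?P" for S
    using bs that bij_betwE by blast
  have es: "t (e S) = e (s S)" if "S \<in> ?P" for S
  proof -
    have "t (e S) \<in> e ` ?P"
      using bij_betwE[OF t(1)] that by (simp add: car)
    then show ?thesis
      by (simp add: s_def f_inv_into_f)
  qed
  have eqI: "S = S'" if "e S = e S'" "S \<in> ?P" "S' \<in> ?P" for S S'
    using e that by (simp add: inj_on_eq_iff)
  show "n dvd m"
  proof (rule automorphism_periodic_sets_order[OF n bs])
    fix S S' assume S: "S \<in> ?P" "S' \<in> ?P"
    then have eS: "e S \<in> carrier D" "e S' \<in> carrier D"
      using car by simp_all
    show "s (S \<union> S') = s S \<union> s S'"
      by (rule eqI) (use S closed s_closed t_ops[OF eS] es in \<open>simp_all add: ops\<close>)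
    show "s (S \<inter> S') = s S \<inter> s S'"
      by (rule eqI) (use S closed s_closed t_ops[OF eS] es in \<open>simp_all add: ops\<close>)
  next
    fix S assume S: "S \<in> ?P"
    then have eS: "e S \<in> carrier D"
      using car by simp
    show "s (shift S) = shift (s S)"
      by (rule eqI) (use S closed s_closed t_ops[OF eS eS] es in \<open>simp_all add: ops\<close>)
    have "(t ^^ k) (e S) = e ((s ^^ k) S) \<and> (s ^^ k) S \<in> ?P" for k
      by (induction k) (use S es s_closed in auto)
    then show "(s ^^ m) S = S"
      using t(3)[OF eS] S eqI by metis
    show "shift S = S" if "s S = S"
      by (rule eqI) (use S that closed t(4)[OF eS] es[OF S] in \<open>simp_all add: ops\<close>)
  qed
qed

lemma RLat_not_term_equivalent:
  assumes inf: "infinite (UNIV :: 'u set)" and "m \<ge> 1" "n \<ge> 1" "m \<noteq> n"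
  shows "\<not> term_equivalent rl_sig (RLat m :: (rl_symbol, 'u) algebra set) rl_sig (RLat n)"
proof
  assume te: "term_equivalent rl_sig (RLat m :: (rl_symbol, 'u) algebra set) rl_sig (RLat n)"
  have "n dvd m" "m dvd n"
    using RLat_term_equivalent_imp_dvd[OF inf] te term_equivalent_sym[OF te] assms(2,3) by blast+
  then show False
    using assms(4) dvd_antisym by blast
qed

section \<open>Comparison with the varieties of projections\<close>

definition first_proj_alg :: "(unit, 'a) algebra" where
  "first_proj_alg = \<lparr>carrier = UNIV, ops = (\<lambda>f xs. hd xs)\<rparr>"

text \<open>One algebra serves all \<open>k\<close>: for \<open>k = 1\<close> there is no operation
  to constrain it, and otherwise it belongs to the joinand \<open>proj_variety k 1\<close>.\<close>

lemma first_proj_alg_S_var: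
  assumes "k \<ge> 1"
  shows "first_proj_alg \<in> S_var k"
proof (cases "k = 1")
  case True
  then show ?thesis
    by (simp add: S_var_def models_def is_algebra_def first_proj_alg_def)
next
  case False
  \<comment> \<open>The variables in the defining identity are numbered from 1, so \<open>hd\<close>
    returns the value of \<open>Var 1\<close>.\<close>
  have "[1..<k + 1] = 1 # [2..<k + 1]"
    using assms by (simp add: upt_conv_Cons numeral_2_eq_2)
  then have "first_proj_alg \<in> proj_variety k 1"
    by (simp add: proj_variety_def models_def is_algebra_def satisfies_def first_proj_alg_def)
  then show ?thesis
    using assms False by (auto simp: S_var_def variety_join_def)
qed

text \<open>Passing repeatedly to the first argument ends at the leftmost variable of the term,
  which is the required \<open>i\<close>. For \<open>k = 1\<close> the type has no symbols and the
  case \<open>App\<close> is vacuous.\<close>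

lemma eval_first_proj_alg:
  assumes "k \<ge> 1" "wf_trm (S_sig k) t"
  shows "\<exists>i\<in>vars t. \<forall>\<rho> :: nat \<Rightarrow> 'a. eval_trm first_proj_alg \<rho> t = \<rho> i"
  using assms(2)
proof (induction t)
  case (App f ts)
  then have "length ts = k"
    by (simp add: S_sig_def split: if_splits)
  then obtain t ts' where ts: "ts = t # ts'"
    using assms(1) by (cases ts) auto
  then have "\<exists>i\<in>vars t. \<forall>\<rho> :: nat \<Rightarrow> 'a. eval_trm first_proj_alg \<rho> t = \<rho> i"
    using App by simp
  then show ?case
    by (auto simp: ts first_proj_alg_def)
qed simp

lemma RLat_not_term_equivalent_S_var:
  assumes inf: "infinite (UNIV :: 'u set)" and k: "k \<ge> 1"
  shows "\<not> term_equivalent rl_sig (RLat n :: (rl_symbol, 'u) algebra set) (S_sig k) (S_var k)"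
proof
  assume "term_equivalent rl_sig (RLat n :: (rl_symbol, 'u) algebra set) (S_sig k) (S_var k)"
  then obtain \<sigma> where \<sigma>: "interprets rl_sig (S_sig k) \<sigma>"
    and RL: "\<And>B :: (unit, 'u) algebra. B \<in> S_var k \<Longrightarrow> term_reduct \<sigma> B \<in> RLat n"
    unfolding term_equivalent_def by blast
  define A :: "(rl_symbol, 'u) algebra" where "A = term_reduct \<sigma> first_proj_alg"
  have A: "A \<in> RLat n"
    unfolding A_def by (rule RL[OF first_proj_alg_S_var[OF k]])
  have car: "carrier A = UNIV"
    by (simp add: A_def term_reduct_def first_proj_alg_def)
  have "rl_sig Join = Some 2"
    by (simp add: rl_sig_def)
  then have wf: "wf_trm (S_sig k) (\<sigma> Join)" "vars (\<sigma> Join) \<subseteq> {..<2}"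
    using \<sigma> unfolding interprets_def by blast+
  then obtain i where i: "i < 2"
    "\<And>\<rho> :: nat \<Rightarrow> 'u. eval_trm first_proj_alg \<rho> (\<sigma> Join) = \<rho> i"
    using eval_first_proj_alg[OF k wf(1)] by blast
  have "ops A Join [x, y] = [x, y] ! i" for x y
    by (simp add: A_def term_reduct_def i(2))
  moreover have "ops A Join [x, y] = ops A Join [y, x]" for x y
    using A car unfolding RLat_iff lattice_on_def by blast
  ultimately have "[x, y] ! i = [y, x] ! i" for x y :: 'u
    by metis
  then have "x = y" for x y :: 'u
    using i(1) by (auto simp: less_2_cases_iff)
  then have "(UNIV :: 'u set) \<subseteq> {undefined}"
    by blast
  then show False
    using inf finite_subset by blast
qed

theorem mainTheorem4:
  assumes "infinite (UNIV :: 'u set)"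
  shows "(\<forall>n\<ge>1. strongly_tolerance_factorable rl_sig
                   (RLat n :: (rl_symbol, 'a) algebra set)
                   (RLat n :: (rl_symbol, 'a set) algebra set)) \<and>
         (\<forall>m\<ge>1. \<forall>n\<ge>1. m \<noteq> n \<longrightarrow>
            \<not> term_equivalent rl_sig (RLat m :: (rl_symbol, 'u) algebra set)
                              rl_sig (RLat n :: (rl_symbol, 'u) algebra set)) \<and>
         (\<forall>n\<ge>1. has_proper_tolerances rl_sig (RLat n :: (rl_symbol, 'u) algebra set)) \<and>
         (\<forall>n\<ge>1. \<forall>k\<ge>1.
            \<not> term_equivalent rl_sig (RLat n :: (rl_symbol, 'u) algebra set)
                              (S_sig k) (S_var k :: (unit, 'u) algebra set))"
proof (intro conjI allI impI)
  show "strongly_tolerance_factorable rl_sig (RLat n :: (rl_symbol, 'a) algebra set) (RLat n)"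
    if "n \<ge> 1" for n
    using that by (rule strongly_tolerance_factorable_RLat)
  show "has_proper_tolerances rl_sig (RLat n :: (rl_symbol, 'u) algebra set)" if "n \<ge> 1" for n
    using assms that by (rule has_proper_tolerances_RLat)
  show "\<not> term_equivalent rl_sig (RLat m :: (rl_symbol, 'u) algebra set) rl_sig (RLat n)"
    if "m \<ge> 1" "n \<ge> 1" "m \<noteq> n" for m n
    using assms that by (rule RLat_not_term_equivalent)
  show "\<not> term_equivalent rl_sig (RLat n :: (rl_symbol, 'u) algebra set)
      (S_sig k) (S_var k :: (unit, 'u) algebra set)" if "k \<ge> 1" for n k
    using assms that by (rule RLat_not_term_equivalent_S_var)
qed

end
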